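(* Let $f$ be $(s,p)$-valent in the unit disk $D_1$ and have exactly $s$ zeroes $x_1,\dots,x_s$ in $D_1$ (counted with multiplicity). Let $P(x)=A\prod_{j=1}^s(x-x_j)$, where the constant $A\neq0$ is chosen so that the holomorphic function $f/P$ (with removable singularities removed) takes the value $1$ at $0$. Then for every $x\in D_1$, $$\Big(\frac{1-|x|}{1+|x|}\Big)^{2p}\le \Big|\frac{f(x)}{P(x)}\Big|\le\Big(\frac{1+|x|}{1-|x|}\Big)^{2p}.$$
   Context: $D_r=\{z\in\mathbb C:|z|<r\}$. A function $f$ regular in a domain $\Omega$ is $(s,p)$-valent in $\Omega$ if for every polynomial $P$ of degree at most $s$ the equation $f(z)=P(z)$ has at most $p$ solutions in $\Omega$, counted with multiplicity. *)

theory Defs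
  imports "HOL-Analysis.Analysis" "HOL-Computational_Algebra.Polynomial"
    "HOL-Library.Extended_Nat" "HOL-Library.Multiset"
begin

definition zero_mult :: "(complex \<Rightarrow> complex) \<Rightarrow> complex \<Rightarrow> nat" where
  "zero_mult g z = (LEAST n. (deriv ^^ n) g z \<noteq> 0)"

definition num_zeros :: "(complex \<Rightarrow> complex) \<Rightarrow> complex set \<Rightarrow> enat" where
  "num_zeros g S = (if finite {z \<in> S. g z = 0}
      then enat (\<Sum>z\<in>{z \<in> S. g z = 0}. zero_mult g z) else \<infinity>)"

definition sp_valent :: "nat \<Rightarrow> nat \<Rightarrow> (complex \<Rightarrow> complex) \<Rightarrow> complex set \<Rightarrow> bool" where
  "sp_valent s p f \<Omega> \<longleftrightarrow> f holomorphic_on \<Omega> \<and>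
     (\<forall>Q :: complex poly. degree Q \<le> s \<longrightarrow> num_zeros (\<lambda>z. f z - poly Q z) \<Omega> \<le> enat p)"

end

theory Submission
  imports Defs "HOL-Complex_Analysis.Complex_Analysis"
begin

text \<open>
  The quotient \<open>g = f / P\<close> has no zeros, and since \<open>f - c P = P (g - c)\<close> with \<open>c P\<close> of degree at most
  \<open>s\<close>, every \<open>g - c\<close> has at most \<open>p\<close> zeros. So it suffices to bound \<open>Re L\<close> for \<open>L = log g\<close> by
  \<open>2 p ln ((1 + \<bar>x\<bar>) / (1 - \<bar>x\<bar>))\<close>, the value for the map \<open>2 p log ((1 + x) / (1 - x))\<close> onto a strip,
  and to apply this to \<open>g\<close> and \<open>1 / g\<close>.

  Let \<open>N u t\<close> be the integral of \<open>(Re L - u)\<^sup>+\<close> over the circle of radius \<open>r e\<^sup>-\<^sup>t\<close>. Two facts about \<open>N\<close>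
  are used. Jensen's formula for \<open>g - e\<^sup>u cis \<eta>\<close>, averaged over \<open>\<eta>\<close>, shows that \<open>p\<close>-valence means
  \<open>- \<partial>N/\<partial>t \<le> 2 \<pi> p\<close>. Harmonicity of \<open>Re L\<close> and the Cauchy-Schwarz inequality show that \<open>N\<close> satisfies
  the Monge-Ampere inequality \<open>N_uu N_tt - N_ut\<^sup>2 \<ge> 4\<close> (in a weak sense) wherever the level \<open>u\<close> is crossed.
  For the strip map both hold with equality. A maximum principle, applied to \<open>N\<close> minus a slightly
  perturbed strip function, gives \<open>N \<le>\<close> the strip function, and comparing supports gives the
  bound for \<open>Re L\<close>.
\<close>

section \<open>The strip function\<close>

text \<open>The constant 4 is a squared count: a level strictly between the extremes of
  \<open>Re L\<close> is crossed at least twice on a circle. Heuristically, \<open>N_uu\<close> is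
  the sum of 1/|U_\<phi>| over the crossings, while harmonicity turns the integral of U_tt over U >
  u into the sum of |U_\<phi>|; Cauchy-Schwarz bounds the product below by the squared number of
  crossings. No second derivatives of \<open>N\<close> are taken: the inequality is tested by second
  differences at a maximum of \<open>N\<close> minus a smooth function.

  Equality for the strip map is the obstacle, since a maximum principle needs strictness. The
  comparison function is therefore \<open>q * strip_mean (u / q) (c * t + e)\<close> with 0 < c < 1,
  e > 0 and q = 2 p / c^2. Slowing the time by c lowers the determinant to 4 c^2. Of the two factors
  c in q, one compensates the slower time in the slope at t = 0, the other leaves room for an
  arctangent that stays below pi / 2 once the shift e keeps the function away from its singular
  boundary. The shift disappears when supports are compared, and c tends to 1 at the very
  end.\<close>

lemma tanh_artanh_real:
  fixes x :: real
  assumes "\<bar>x\<bar> < 1"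
  shows "tanh (artanh x) = x"
proof -
  have pos: "(1 + x) / (1 - x) > 0" using assms by auto
  have e: "exp (2 * artanh x) = (1 + x) / (1 - x)"
    using pos by (simp add: artanh_def)
  have "tanh (artanh x) = (exp (2 * artanh x) - 1) / (exp (2 * artanh x) + 1)"
  proof -
    have "exp (2 * artanh x) = exp (artanh x) * exp (artanh x)"
      by (simp flip: exp_add)
    moreover have "exp (artanh x) * exp (artanh x) + 1 > 0" by (intro add_nonneg_pos) auto
    ultimately show ?thesis
      unfolding tanh_def sinh_def cosh_def exp_minus
      by (simp add: divide_simps)
  qed
  also have "\<dots> = x" unfolding e using assms by (simp add: field_simps)
  finally show ?thesis .
qed

text \<open>For t > 0 this is the real part of log ((1 + x) / (1 - x)) at x = e^(-t + i \<phi>), a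
  conformal map of the disc onto the strip |Im| < pi / 2.\<close>

definition strip_log :: "real \<Rightarrow> real \<Rightarrow> real" where
  "strip_log t \<phi> = artanh (cos \<phi> / cosh t)"

text \<open>The factor 2 stands for the other half of the circle, \<open>strip_log t\<close> being
  even. This is the circular mean \<open>N\<close> of the overview for the strip map.\<close>

definition strip_mean :: "real \<Rightarrow> real \<Rightarrow> real" where
  "strip_mean u t = 2 * integral {0..pi} (\<lambda>\<phi>. max 0 (strip_log t \<phi> - u))"

text \<open>The angle at which \<open>strip_log t\<close> falls to the level \<open>u\<close>. The
  clamp yields 0 for levels above the range and pi for levels below it, so that the formulas for the
  mean need no case distinction.\<close>

definition strip_angle :: "real \<Rightarrow> real \<Rightarrow> real" where
  "strip_angle u t = arccos (max (- 1) (min 1 (cosh t * tanh u)))"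

lemma strip_log_arg_bound:
  fixes t \<phi> :: real
  assumes "t > 0"
  shows "\<bar>cos \<phi> / cosh t\<bar> < 1"
proof -
  have "1 < cosh t" using assms using cosh_real_strict_mono[of 0 t] by simp
  then have "\<bar>cos \<phi>\<bar> < cosh t" by (meson abs_cos_le_one order_le_less_trans)
  then show ?thesis by simp
qed

lemma strip_log_greater_iff:
  assumes "t > 0"
  shows "u < strip_log t \<phi> \<longleftrightarrow> cosh t * tanh u < cos \<phi>"
proof -
  have "u < strip_log t \<phi> \<longleftrightarrow> tanh u < tanh (strip_log t \<phi>)" by simp
  also have "\<dots> \<longleftrightarrow> tanh u < cos \<phi> / cosh t"
    unfolding strip_log_def by (subst tanh_artanh_real[OF strip_log_arg_bound[OF assms]]) simp
  also have "\<dots> \<longleftrightarrow> cosh t * tanh u < cos \<phi>"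
    by (simp add: pos_less_divide_eq mult.commute)
  finally show ?thesis .
qed

lemma continuous_on_strip_log [continuous_intros]:
  fixes a b :: "'a::t2_space \<Rightarrow> real"
  assumes "continuous_on S a" "continuous_on S b" "\<And>x. x \<in> S \<Longrightarrow> a x > 0"
  shows "continuous_on S (\<lambda>x. strip_log (a x) (b x))"
proof -
  have bound: "cos (b x) / cosh (a x) \<in> {-1<..<1}" if "x \<in> S" for x
    using strip_log_arg_bound[OF assms(3)[OF that], of "b x"] unfolding abs_less_iff by auto
  show ?thesis
    unfolding strip_log_def
  proof (rule continuous_on_compose2[of "{-1<..<1}" artanh S])
    show "continuous_on S (\<lambda>x. cos (b x) / cosh (a x))"
      by (intro continuous_intros assms) auto
  qed (use bound in \<open>auto intro!: continuous_on_artanh simp del: divide_less_eq_1\<close>)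
qed

lemma strip_angle_bounds: "0 \<le> strip_angle u t" "strip_angle u t \<le> pi"
  unfolding strip_angle_def by (auto intro: arccos_lbound arccos_ubound)

lemma cos_strip_angle: "cos (strip_angle u t) = max (- 1) (min 1 (cosh t * tanh u))"
  unfolding strip_angle_def by (intro cos_arccos) auto

lemma continuous_on_strip_angle [continuous_intros]:
  fixes a b :: "'a::t2_space \<Rightarrow> real"
  assumes "continuous_on S a" "continuous_on S b"
  shows "continuous_on S (\<lambda>x. strip_angle (a x) (b x))"
proof -
  have "cosh (a x) \<noteq> 0" for x by (metis cosh_real_nonzero)
  then show ?thesis
    unfolding strip_angle_def by (intro continuous_intros assms) auto
qed

lemma strip_log_integrable:
  assumes "t > 0"
  shows "strip_log t integrable_on {a..b}"
    "(\<lambda>\<phi>. strip_log t \<phi> - u) integrable_on {a..b}"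
    "(\<lambda>\<phi>. max 0 (strip_log t \<phi> - u)) integrable_on {a..b}"
  using assms by (auto intro!: integrable_continuous_interval continuous_intros)

text \<open>Together with \<open>strip_mean_eq\<close> this presents the strip mean as a maximum
  over the upper limit \<open>b\<close>, attained at the strip angle.\<close>

lemma strip_mean_ge:
  assumes "t > 0" "0 \<le> b" "b \<le> pi"
  shows "2 * integral {0..b} (\<lambda>\<phi>. strip_log t \<phi> - u) \<le> strip_mean u t"
proof -
  have "integral {0..b} (\<lambda>\<phi>. strip_log t \<phi> - u) \<le> integral {0..b} (\<lambda>\<phi>. max 0 (strip_log t \<phi> - u))"
    using assms by (intro integral_le strip_log_integrable) auto
  also have "\<dots> \<le> integral {0..pi} (\<lambda>\<phi>. max 0 (strip_log t \<phi> - u))"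
    using assms by (intro integral_subset_le strip_log_integrable) auto
  finally show ?thesis unfolding strip_mean_def by simp
qed

lemma strip_mean_eq:
  assumes "t > 0"
  shows "strip_mean u t = 2 * integral {0..strip_angle u t} (\<lambda>\<phi>. strip_log t \<phi> - u)"
proof -
  define b where "b = strip_angle u t"
  note b = strip_angle_bounds[of u t, folded b_def]
  have cb: "cos b = max (- 1) (min 1 (cosh t * tanh u))"
    unfolding b_def by (rule cos_strip_angle)
  have le_iff: "u \<le> strip_log t \<phi> \<longleftrightarrow> cosh t * tanh u \<le> cos \<phi>" for \<phi>
  proof -
    have "strip_log t \<phi> < u \<longleftrightarrow> tanh (strip_log t \<phi>) < tanh u" by simp
    also have "\<dots> \<longleftrightarrow> cos \<phi> < cosh t * tanh u"
      unfolding strip_log_def tanh_artanh_real[OF strip_log_arg_bound[OF assms]]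
      by (simp add: pos_divide_less_eq mult.commute)
    finally show ?thesis by linarith
  qed
  have "integral {0..pi} (\<lambda>\<phi>. max 0 (strip_log t \<phi> - u))
      = integral {0..b} (\<lambda>\<phi>. max 0 (strip_log t \<phi> - u)) + integral {b..pi} (\<lambda>\<phi>. max 0 (strip_log t \<phi> - u))"
    using b assms by (intro Henstock_Kurzweil_Integration.integral_combine[symmetric] strip_log_integrable) auto
  also have "integral {0..b} (\<lambda>\<phi>. max 0 (strip_log t \<phi> - u)) = integral {0..b} (\<lambda>\<phi>. strip_log t \<phi> - u)"
  proof (cases "b = 0")
    case False
    \<comment> \<open>A nonzero \<open>b\<close> means that the clamp at 1 is inactive; the clamp at
      -1 can only raise \<open>cos b\<close>.\<close>
    have "cos b \<noteq> 1" using cos_inj_pi[of b 0] False b by auto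
    then have "cosh t * tanh u \<le> cos b" unfolding cb by linarith
    moreover have "cos b \<le> cos \<phi>" if "\<phi> \<in> {0..b}" for \<phi>
      using that b by (intro cos_monotone_0_pi_le) auto
    ultimately show ?thesis
      by (intro integral_cong) (force simp: le_iff)
  qed simp
  also have "integral {b..pi} (\<lambda>\<phi>. max 0 (strip_log t \<phi> - u)) = 0"
  proof (cases "b = pi")
    case False
    have "cos b \<noteq> -1" using cos_inj_pi[of b pi] False b by auto
    then have "cos b \<le> cosh t * tanh u" unfolding cb by linarith
    moreover have "cos \<phi> \<le> cos b" if "\<phi> \<in> {b..pi}" for \<phi>
      using that b by (intro cos_monotone_0_pi_le) auto
    ultimately have "max 0 (strip_log t \<phi> - u) = 0" if "\<phi> \<in> {b..pi}" for \<phi>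
      using strip_log_greater_iff[OF assms, of u \<phi>] that by fastforce
    then have "integral {b..pi} (\<lambda>\<phi>. max 0 (strip_log t \<phi> - u)) = integral {b..pi} (\<lambda>_. 0)"
      by (intro integral_cong)
    then show ?thesis by simp
  qed simp
  finally show ?thesis unfolding strip_mean_def b_def by simp
qed

lemma strip_mean_nonneg: "0 \<le> strip_mean u t"
  unfolding strip_mean_def by (cases "(\<lambda>\<phi>. max 0 (strip_log t \<phi> - u)) integrable_on {0..pi}")
    (auto intro: integral_nonneg simp: not_integrable_integral)

lemma strip_mean_eq_0:
  assumes "t > 0" "1 \<le> cosh t * tanh u"
  shows "strip_mean u t = 0"
proof -
  have "strip_angle u t = 0" using assms by (simp add: strip_angle_def)
  then show ?thesis using strip_mean_eq[OF assms(1), of u] by simp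
qed

lemma strip_log_reflect: "t > 0 \<Longrightarrow> strip_log t (pi - \<phi>) = - strip_log t \<phi>"
  unfolding strip_log_def using artanh_minus_real[OF strip_log_arg_bound] by simp

text \<open>The reflection of \<phi> to pi - \<phi> negates \<open>strip_log\<close>, which
  therefore has mean 0; the rest is y^+ - y = (-y)^+. It turns the lower edge of the strip into an
  upper one.\<close>

lemma strip_mean_minus:
  assumes "t > 0"
  shows "strip_mean (- u) t = strip_mean u t + 2 * pi * u"
proof -
  have refl: "integral {0..pi} (\<lambda>\<phi>. f (pi - \<phi>)) = integral {0..pi} f" for f :: "real \<Rightarrow> real"
    using Henstock_Kurzweil_Integration.integral_reflect_real[of 0 "-pi" "\<lambda>x. f (x + pi)"]
      integral_shift_real_ivl[of 0 pi pi f] by simp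
  have mean: "integral {0..pi} (strip_log t) = 0"
    using refl[of "strip_log t"] assms by (simp add: strip_log_reflect)
  have "integral {0..pi} (\<lambda>\<phi>. max 0 (strip_log t \<phi> + u)) = integral {0..pi} (\<lambda>\<phi>. max 0 (u - strip_log t \<phi>))"
    using refl[of "\<lambda>\<phi>. max 0 (strip_log t \<phi> + u)"] assms by (simp add: strip_log_reflect add.commute)
  also have "\<dots> = integral {0..pi} (\<lambda>\<phi>. max 0 (strip_log t \<phi> - u) - (strip_log t \<phi> - u))"
    by (intro integral_cong) auto
  also have "\<dots> = integral {0..pi} (\<lambda>\<phi>. max 0 (strip_log t \<phi> - u)) - integral {0..pi} (\<lambda>\<phi>. strip_log t \<phi> - u)"
    using assms by (intro integral_diff strip_log_integrable)
  also have "integral {0..pi} (\<lambda>\<phi>. strip_log t \<phi> - u) = - u * pi"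
    using assms by (subst integral_diff) (auto intro: strip_log_integrable simp: mean)
  finally show ?thesis unfolding strip_mean_def by (simp add: algebra_simps)
qed

lemma continuous_on_strip_mean:
  "continuous_on (UNIV \<times> {0<..}) (\<lambda>(u, t). strip_mean u t)"
proof -
  have "continuous_on (UNIV \<times> {0<..}) (\<lambda>x. integral (cbox 0 pi) (\<lambda>\<phi>. max 0 (strip_log (snd x) \<phi> - fst x)))"
    by (intro integral_continuous_on_param) (auto simp: split_beta intro!: continuous_intros)
  then show ?thesis unfolding strip_mean_def split_beta by (auto intro!: continuous_intros)
qed

text \<open>Cauchy-Riemann: the t-derivative of the integrand is an exact \<phi>-derivative, because
  arctan (sin \<phi> / sinh t) is the imaginary part of log ((1 + x) / (1 - x)).\<close>

lemma has_real_derivative_integral_strip_log: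
  assumes "t > 0" "0 \<le> b"
  shows "((\<lambda>t. integral {0..b} (strip_log t)) has_real_derivative - arctan (sin b / sinh t)) (at t)"
proof -
  define D where "D = (\<lambda>t \<phi>::real. - (cos \<phi> * sinh t) / ((sinh t)\<^sup>2 + (sin \<phi>)\<^sup>2))"
  have pos: "(sinh t)\<^sup>2 + (sin \<phi>)\<^sup>2 > 0" if "t > 0" for t \<phi> :: real
    using that by (intro add_pos_nonneg) auto
  have D: "((\<lambda>t. strip_log t \<phi>) has_real_derivative D t \<phi>) (at t within S)" if "t > 0" for t \<phi> S
  proof -
    have n0: "cosh t \<noteq> 0" by simp
    have "(sinh t)\<^sup>2 + (sin \<phi>)\<^sup>2 = (cosh t)\<^sup>2 - (cos \<phi>)\<^sup>2"
      using cosh_square_eq[of t] sin_cos_squared_add[of \<phi>] by linarith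
    then have "1 - (cos \<phi> / cosh t)\<^sup>2 = ((sinh t)\<^sup>2 + (sin \<phi>)\<^sup>2) / (cosh t)\<^sup>2"
      using n0 by (simp add: power_divide diff_divide_distrib)
    then have e: "1 / (1 - (cos \<phi> / cosh t)\<^sup>2) * (- (cos \<phi> * sinh t) / (cosh t * cosh t)) = D t \<phi>"
      unfolding D_def using pos[OF that] by (simp add: power2_eq_square)
    show ?thesis
      unfolding strip_log_def e[symmetric]
      by (rule DERIV_chain'[where g=artanh])
         (auto intro!: derivative_eq_intros artanh_real_has_field_derivative strip_log_arg_bound that simp del: abs_divide)
  qed
  have "((\<lambda>t. integral (cbox 0 b) (strip_log t)) has_real_derivative integral (cbox 0 b) (D t)) (at t within {0<..})"
  proof (rule leibniz_rule_field_derivative)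
    show "continuous_on ({0<..} \<times> cbox 0 b) (\<lambda>(x, t). D x t)"
      unfolding D_def split_beta using pos
      by (intro continuous_intros) (auto dest!: pos simp: less_imp_neq[symmetric])
  qed (use assms D in \<open>auto intro: strip_log_integrable\<close>)
  moreover have "(D t has_integral - arctan (sin b / sinh t) - - arctan (sin 0 / sinh t)) {0..b}"
  proof (rule fundamental_theorem_of_calculus)
    fix x assume "x \<in> {0..b}"
    have s: "sinh t > 0" using assms by simp
    have "((\<lambda>x. - arctan (sin x / sinh t)) has_real_derivative - (inverse (1 + (sin x / sinh t)\<^sup>2) * (cos x / sinh t))) (at x within {0..b})"
      using s by (auto intro!: derivative_eq_intros)
    also have "- (inverse (1 + (sin x / sinh t)\<^sup>2) * (cos x / sinh t)) = D t x"
      using s pos[OF assms(1), of x] by (simp add: D_def field_simps power2_eq_square)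
    finally show "((\<lambda>x. - arctan (sin x / sinh t)) has_vector_derivative D t x) (at x within {0..b})"
      by (simp add: has_real_derivative_iff_has_vector_derivative)
  qed (use assms in auto)
  ultimately show ?thesis
    using assms by (simp add: integral_unique at_within_open[of t "{0<..}"])
qed

text \<open>Envelope argument: a maximum over \<open>b\<close> of the smooth functions
  \<open>F b\<close> has the derivative of \<open>F b\<close> with the maximising angle held fixed.
  Only continuity of the angle is used, so the formula also holds at the edges of the strip, where
  arccos is not differentiable.\<close>

lemma strip_mean_line_deriv:
  assumes t: "t > 0"
  shows "((\<lambda>h. strip_mean (u + \<alpha> * h) (t + \<beta> * h)) has_real_derivative
    - 2 * \<alpha> * strip_angle u t - 2 * \<beta> * arctan (sin (strip_angle u t) / sinh t)) (at 0)"
proof -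
  define F where "F = (\<lambda>b h. 2 * integral {0..b} (\<lambda>\<phi>. strip_log (t + \<beta> * h) \<phi> - (u + \<alpha> * h)))"
  define F' where "F' = (\<lambda>b h. - 2 * \<alpha> * b - 2 * \<beta> * arctan (sin b / sinh (t + \<beta> * h)))"
  define b where "b = (\<lambda>h. strip_angle (u + \<alpha> * h) (t + \<beta> * h))"
  define n where "n = (\<lambda>h. strip_mean (u + \<alpha> * h) (t + \<beta> * h))"
  define S where "S = {h. t + \<beta> * h > 0}"
  have "S = {h. - t < \<beta> \<bullet> h}" unfolding S_def by auto
  then have "convex S" by (simp only: convex_halfspace_gt)
  then have S: "open S" "0 \<in> S" "convex S" unfolding S_def using t
    by (auto intro!: open_Collect_less continuous_intros)
  have bb: "0 \<le> b h" "b h \<le> pi" for h unfolding b_def by (rule strip_angle_bounds)+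
  have F_deriv: "(F c has_real_derivative F' c h) (at h)" if "h \<in> S" "0 \<le> c" for c h
  proof -
    have *: "F c h = 2 * (integral {0..c} (strip_log (t + \<beta> * h)) - (u + \<alpha> * h) * c)" if "h \<in> S" for h
      unfolding F_def using that \<open>0 \<le> c\<close>
      by (subst integral_diff) (auto intro: strip_log_integrable simp: S_def)
    have "((\<lambda>h. integral {0..c} (strip_log (t + \<beta> * h))) has_real_derivative - arctan (sin c / sinh (t + \<beta> * h)) * \<beta>) (at h)"
      using that by (intro DERIV_chain'[where g="\<lambda>t. integral {0..c} (strip_log t)", OF _ has_real_derivative_integral_strip_log])
        (auto intro!: derivative_eq_intros simp: S_def)
    then have "((\<lambda>h. 2 * (integral {0..c} (strip_log (t + \<beta> * h)) - (u + \<alpha> * h) * c)) has_real_derivative F' c h) (at h)"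
      unfolding F'_def by (auto intro!: derivative_eq_intros)
    then show ?thesis
      by (rule has_field_derivative_transform_within_open[OF _ S(1) that(1)]) (simp add: *)
  qed
  have n_ge: "F c h \<le> n h" if "h \<in> S" "0 \<le> c" "c \<le> pi" for c h
    unfolding F_def n_def using that by (intro strip_mean_ge) (auto simp: S_def)
  have n_eq: "n h = F (b h) h" if "h \<in> S" for h
    unfolding F_def n_def b_def using that by (intro strip_mean_eq) (auto simp: S_def)
  have F'_cont: "((\<lambda>h. F' (f h) (g h)) \<longlongrightarrow> F' (b 0) 0) (at 0)" if "(f \<longlongrightarrow> b 0) (at 0)" "(g \<longlongrightarrow> 0) (at 0)" for f g :: "real \<Rightarrow> real"
    unfolding F'_def using t by (intro tendsto_intros that) auto
  have b_cont: "(b \<longlongrightarrow> b 0) (at 0)"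
  proof -
    have "continuous_on UNIV b" unfolding b_def by (intro continuous_intros)
    then show ?thesis by (simp add: continuous_on_eq_continuous_at continuous_at isContD)
  qed
  have mvt: "\<exists>k. \<bar>k\<bar> \<le> \<bar>h\<bar> \<and> F c h - F c 0 = h * F' c k" if "h \<in> S" "0 \<le> c" for c h
  proof (cases "h = 0")
    case False
    note c = that(2)
    have seg: "closed_segment 0 h \<subseteq> S" using S that by (simp add: closed_segment_subset)
    have "\<exists>k. (if 0 < h then 0 < k \<and> k < h else h < k \<and> k < 0) \<and> F c h - F c 0 = h * F' c k"
    proof (cases "0 < h")
      case True
      then show ?thesis using MVT2[of 0 h "F c" "F' c"] F_deriv[OF _ c] seg
        by (auto simp: closed_segment_eq_real_ivl subset_iff)
    next
      case f: False
      then have "h < 0" using False by auto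
      then obtain k where "h < k" "k < 0" "F c 0 - F c h = (0 - h) * F' c k"
        using MVT2[of h 0 "F c" "F' c"] F_deriv[OF _ c] seg
        by (auto simp: closed_segment_eq_real_ivl subset_iff)
      then show ?thesis using f by (intro exI[of _ k]) auto
    qed
    then obtain k where "if 0 < h then 0 < k \<and> k < h else h < k \<and> k < 0" "F c h - F c 0 = h * F' c k"
      by blast
    then show ?thesis by (intro exI[of _ k]) (auto split: if_splits)
  qed auto
  have ex: "\<exists>k. \<forall>h. h \<in> S \<longrightarrow> \<bar>k h\<bar> \<le> \<bar>h\<bar> \<and> F (c h) h - F (c h) 0 = h * F' (c h) (k h)" if "\<And>h. 0 \<le> c h" for c
  proof -
    have "\<forall>h. \<exists>k. h \<in> S \<longrightarrow> \<bar>k\<bar> \<le> \<bar>h\<bar> \<and> F (c h) h - F (c h) 0 = h * F' (c h) k"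
      using mvt[OF _ that] by blast
    then show ?thesis by (rule choice)
  qed
  obtain k1 where k1: "\<And>h. h \<in> S \<Longrightarrow> \<bar>k1 h\<bar> \<le> \<bar>h\<bar> \<and> F (b 0) h - F (b 0) 0 = h * F' (b 0) (k1 h)"
    using ex[of "\<lambda>_. b 0"] bb by auto
  obtain k2 where k2: "\<And>h. h \<in> S \<Longrightarrow> \<bar>k2 h\<bar> \<le> \<bar>h\<bar> \<and> F (b h) h - F (b h) 0 = h * F' (b h) (k2 h)"
    using ex[of b] bb by auto
  have ev: "eventually (\<lambda>h. h \<in> S) (at 0)" using S by (intro eventually_at_in_open') auto
  have kl: "(k \<longlongrightarrow> 0) (at 0)" if "\<And>h. h \<in> S \<Longrightarrow> \<bar>k h\<bar> \<le> \<bar>h\<bar>" for k :: "real \<Rightarrow> real"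
    by (rule Lim_null_comparison[where g="\<lambda>h. \<bar>h\<bar>"])
       (use ev in \<open>auto elim!: eventually_mono simp: that intro!: tendsto_eq_intros\<close>)
  define d1 d2 where "d1 = (\<lambda>h. F' (b 0) (k1 h))" and "d2 = (\<lambda>h. F' (b h) (k2 h))"
  have lim: "(d1 \<longlongrightarrow> F' (b 0) 0) (at 0)" "(d2 \<longlongrightarrow> F' (b 0) 0) (at 0)"
    unfolding d1_def d2_def using k1 k2 b_cont by (auto intro!: F'_cont kl)
  \<comment> \<open>The optimal angle at 0 is a competitor at \<open>h\<close>, and the optimal
    angle at \<open>h\<close> a competitor at 0; this traps the increment between two mean-value
    expressions with the same limit.\<close>
  have up: "n h - n 0 \<le> h * d2 h" and lo: "h * d1 h \<le> n h - n 0" if "h \<in> S" for h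
    using n_eq[OF that] n_ge[OF S(2), of "b h"] bb k2[OF that] n_eq[OF S(2)] n_ge[OF that, of "b 0"] k1[OF that]
    unfolding d1_def d2_def by auto
  \<comment> \<open>Dividing by a negative \<open>h\<close> exchanges the two bounds, hence the
    minimum and maximum.\<close>
  have b1: "min (d1 h) (d2 h) \<le> (n h - n 0) / h \<and> (n h - n 0) / h \<le> max (d1 h) (d2 h)" if "h \<in> S" "h \<noteq> 0" for h
    using up[OF that(1)] lo[OF that(1)] that(2)
    by (cases "h > 0") (auto simp: field_simps min_le_iff_disj le_max_iff_disj)
  have ev0: "eventually (\<lambda>h. h \<in> S \<and> h \<noteq> 0) (at (0::real))"
    using ev eventually_neq_at_within[of 0 0 UNIV] by (rule eventually_conj)
  have "((\<lambda>h. (n h - n 0) / h) \<longlongrightarrow> F' (b 0) 0) (at 0)"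
  proof (rule tendsto_sandwich)
    show "((\<lambda>h. min (d1 h) (d2 h)) \<longlongrightarrow> F' (b 0) 0) (at 0)" using tendsto_min[OF lim] by simp
    show "((\<lambda>h. max (d1 h) (d2 h)) \<longlongrightarrow> F' (b 0) 0) (at 0)" using tendsto_max[OF lim] by simp
    show "eventually (\<lambda>h. min (d1 h) (d2 h) \<le> (n h - n 0) / h) (at 0)"
      by (rule eventually_mono[OF ev0]) (use b1 in blast)
    show "eventually (\<lambda>h. (n h - n 0) / h \<le> max (d1 h) (d2 h)) (at 0)"
      by (rule eventually_mono[OF ev0]) (use b1 in blast)
  qed
  then have "(n has_real_derivative F' (b 0) 0) (at 0)" by (simp add: has_field_derivative_iff)
  then show ?thesis unfolding n_def F'_def b_def by simp
qed

text \<open>The integrand is at most \<open>h\<close>, and the arc where it is positive shrinks to a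
  point as \<open>h\<close> tends to 0. Hence the strip mean is o(h) at distance \<open>h\<close>
  inside an edge.\<close>

lemma strip_mean_edge:
  assumes "t > 0" "1 \<le> cosh t * tanh u" "h \<ge> 0"
  shows "strip_mean (u - h) t \<le> 2 * h * strip_angle (u - h) t"
proof -
  have le: "strip_log t \<phi> \<le> u" for \<phi>
    using strip_log_greater_iff[OF assms(1), of u \<phi>] assms(2) cos_le_one[of \<phi>] by linarith
  have "integral {0..strip_angle (u - h) t} (\<lambda>\<phi>. strip_log t \<phi> - (u - h)) \<le> integral {0..strip_angle (u - h) t} (\<lambda>\<phi>. h)"
    using assms le by (intro integral_le strip_log_integrable) (auto simp: algebra_simps)
  then show ?thesis
    using strip_mean_eq[OF assms(1), of "u - h"] strip_angle_bounds[of "u - h" t] by (simp add: mult_ac)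
qed

section \<open>Second-order behaviour of the strip mean\<close>

lemma strip_angle_line_deriv:
  assumes "\<bar>cosh t * tanh u\<bar> < 1"
  shows "((\<lambda>h. strip_angle (u + \<alpha> * h) (t + \<beta> * h)) has_real_derivative
    - (\<beta> * sinh t * tanh u + \<alpha> * cosh t / (cosh u)\<^sup>2) / sin (strip_angle u t)) (at 0)"
proof -
  define C where "C = (\<lambda>h. cosh (t + \<beta> * h) * tanh (u + \<alpha> * h))"
  have contC: "continuous_on UNIV C" unfolding C_def by (intro continuous_intros) auto
  have C': "(C has_real_derivative \<beta> * sinh t * tanh u + \<alpha> * cosh t / (cosh u)\<^sup>2) (at 0)"
  proof -
    have "1 - (tanh u)\<^sup>2 = 1 / (cosh u)\<^sup>2"
    proof -
      have "1 - (tanh u)\<^sup>2 = ((cosh u)\<^sup>2 - (sinh u)\<^sup>2) / (cosh u)\<^sup>2"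
        by (simp add: tanh_def power_divide diff_divide_distrib)
      then show ?thesis by (simp only: hyperbolic_pythagoras)
    qed
    then show ?thesis unfolding C_def by (auto intro!: derivative_eq_intros)
  qed
  have C0: "-1 < C 0" "C 0 < 1" using assms unfolding C_def by auto
  have sin: "sin (strip_angle u t) = sqrt (1 - (C 0)\<^sup>2)"
    using C0 unfolding strip_angle_def C_def by (simp add: sin_arccos)
  have "((\<lambda>h. arccos (C h)) has_real_derivative inverse (- sqrt (1 - (C 0)\<^sup>2)) * (\<beta> * sinh t * tanh u + \<alpha> * cosh t / (cosh u)\<^sup>2)) (at 0)"
    by (rule DERIV_chain2[OF DERIV_arccos C']) (use C0 in auto)
  also have "inverse (- sqrt (1 - (C 0)\<^sup>2)) * (\<beta> * sinh t * tanh u + \<alpha> * cosh t / (cosh u)\<^sup>2)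
     = - (\<beta> * sinh t * tanh u + \<alpha> * cosh t / (cosh u)\<^sup>2) / sin (strip_angle u t)"
    unfolding sin by (simp add: divide_inverse algebra_simps)
  finally have "((\<lambda>h. arccos (C h)) has_real_derivative - (\<beta> * sinh t * tanh u + \<alpha> * cosh t / (cosh u)\<^sup>2) / sin (strip_angle u t)) (at 0)" .
  moreover have "open (C -` {-1<..<1})" using contC by (intro open_vimage) auto
  ultimately show ?thesis
    using C0 by (elim has_field_derivative_transform_within_open[where S="C -` {-1<..<1}"])
      (auto simp: strip_angle_def C_def)
qed

text \<open>Since \<open>k'\<close> is only assumed differentiable at 0, l'Hopital is applied once
  and the limit is then read off from the two difference quotients of \<open>k'\<close> at
  0.\<close>

lemma second_difference_limit:
  fixes k k' :: "real \<Rightarrow> real"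
  assumes d: "d > 0" "\<And>h. \<bar>h\<bar> < d \<Longrightarrow> (k has_real_derivative k' h) (at h)"
    and k'': "(k' has_real_derivative b) (at 0)"
  shows "((\<lambda>h. (k h + k (- h) - 2 * k 0) / h\<^sup>2) \<longlongrightarrow> b) (at_right 0)"
proof (rule lhopital_right_0)
  have cont: "isCont k 0" using d(2)[of 0] d(1) by (auto intro: DERIV_isCont)
  have "((\<lambda>h. k h + k (- h) - 2 * k 0) \<longlongrightarrow> k 0 + k (- 0) - 2 * k 0) (at 0)"
    by (intro tendsto_intros isCont_tendsto_compose[of _ k]) (use cont in \<open>auto simp: isCont_def\<close>)
  then show "((\<lambda>h. k h + k (- h) - 2 * k 0) \<longlongrightarrow> 0) (at_right 0)"
    by (auto intro: filterlim_mono at_le)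
  show "((\<lambda>h::real. h\<^sup>2) \<longlongrightarrow> 0) (at_right 0)" by (auto intro!: tendsto_eq_intros)
  show "eventually (\<lambda>h::real. h\<^sup>2 \<noteq> 0) (at_right 0)" by (auto simp: eventually_at_filter)
  show "eventually (\<lambda>h::real. 2 * h \<noteq> 0) (at_right 0)" by (auto simp: eventually_at_filter)
  have ev: "eventually (\<lambda>h. \<bar>h\<bar> < d) (at_right (0::real))"
    using d(1) by (auto simp: eventually_at intro!: exI[of _ d])
  show "eventually (\<lambda>h. ((\<lambda>h. k h + k (- h) - 2 * k 0) has_real_derivative k' h - k' (- h)) (at h)) (at_right 0)"
    using ev
  proof eventually_elim
    case (elim h)
    have "((\<lambda>h. k (- h)) has_real_derivative k' (- h) * (- 1)) (at h)"
      by (rule DERIV_chain2[OF d(2)]) (use elim in \<open>auto intro!: derivative_eq_intros\<close>)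
    then show ?case using d(2)[OF elim] by (auto intro!: derivative_eq_intros)
  qed
  show "eventually (\<lambda>h::real. ((\<lambda>h. h\<^sup>2) has_real_derivative 2 * h) (at h)) (at_right 0)"
    by (auto intro!: always_eventually derivative_eq_intros)
  have 1: "((\<lambda>h. (k' h - k' 0) / h) \<longlongrightarrow> b) (at 0)" using k'' by (simp add: has_field_derivative_iff)
  have "((\<lambda>h. (k' (- h) - k' 0) / (- h)) \<longlongrightarrow> b) (at 0)"
    by (rule filterlim_compose[OF 1]) (auto simp: filterlim_at intro!: tendsto_eq_intros eventually_neq_at_within)
  then have "((\<lambda>h. ((k' h - k' 0) / h + (k' (- h) - k' 0) / (- h)) / 2) \<longlongrightarrow> (b + b) / 2) (at 0)"
    by (intro tendsto_intros 1) auto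
  moreover have "((k' h - k' 0) / h + (k' (- h) - k' 0) / (- h)) / 2 = (k' h - k' (- h)) / (2 * h)" for h
    by (cases "h = 0") (simp_all add: field_simps)
  moreover have "(b + b) / 2 = b" by simp
  ultimately have "((\<lambda>h. (k' h - k' (- h)) / (2 * h)) \<longlongrightarrow> b) (at 0)" by (simp only:)
  then show "((\<lambda>h. (k' h - k' (- h)) / (2 * h)) \<longlongrightarrow> b) (at_right 0)"
    by (auto intro: filterlim_mono at_le)
qed

text \<open>The envelope formula gives the first derivative along the whole line. Differentiating it
  once more brings in \<open>b'\<close>, the derivative of the strip angle, which exists because the
  level lies strictly inside the range.\<close>

lemma strip_mean_second_difference:
  fixes \<alpha> \<beta> :: real
  assumes t: "t > 0" and range: "\<bar>cosh t * tanh u\<bar> < 1"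
  defines "b \<equiv> strip_angle u t"
  defines "b' \<equiv> - (\<beta> * sinh t * tanh u + \<alpha> * cosh t / (cosh u)\<^sup>2) / sin b"
  shows "((\<lambda>h. (strip_mean (u + \<alpha> * h) (t + \<beta> * h) + strip_mean (u - \<alpha> * h) (t - \<beta> * h) - 2 * strip_mean u t) / h\<^sup>2)
    \<longlongrightarrow> - 2 * \<alpha> * b' - 2 * \<beta> * ((cos b * b' * sinh t - \<beta> * sin b * cosh t) / ((sinh t)\<^sup>2 + (sin b)\<^sup>2))) (at_right 0)"
proof -
  define B where "B = (\<lambda>h. strip_angle (u + \<alpha> * h) (t + \<beta> * h))"
  define k' where "k' = (\<lambda>h. - 2 * \<alpha> * B h - 2 * \<beta> * arctan (sin (B h) / sinh (t + \<beta> * h)))"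
  define d where "d = t / (\<bar>\<beta>\<bar> + 1)"
  have d: "d > 0" using t by (simp add: d_def)
  have k: "((\<lambda>h. strip_mean (u + \<alpha> * h) (t + \<beta> * h)) has_real_derivative k' h) (at h)" if "\<bar>h\<bar> < d" for h
  proof -
    have "\<bar>h\<bar> * (\<bar>\<beta>\<bar> + 1) < t" using that by (simp add: d_def pos_less_divide_eq)
    then have "\<bar>\<beta> * h\<bar> < t" by (simp add: abs_mult algebra_simps)
    then have "t + \<beta> * h > 0" by linarith
    \<comment> \<open>The line derivative is available only at parameter 0, so the base point is
      moved along the line by \<open>h\<close>.\<close>
    from strip_mean_line_deriv[OF this, of "u + \<alpha> * h" \<alpha> \<beta>]
    have "((\<lambda>e. strip_mean (u + \<alpha> * (h + e)) (t + \<beta> * (h + e))) has_real_derivative k' h) (at 0)"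
      unfolding k'_def B_def by (simp add: algebra_simps)
    then show ?thesis using DERIV_shift[of "\<lambda>h. strip_mean (u + \<alpha> * h) (t + \<beta> * h)" "k' h" 0 h]
      by (simp add: add.commute)
  qed
  have B': "(B has_real_derivative b') (at 0)"
    unfolding B_def b'_def b_def by (rule strip_angle_line_deriv[OF range])
  have B0: "B 0 = b" by (simp add: B_def b_def)
  have s: "sinh t > 0" using t by simp
  have p: "(sinh t)\<^sup>2 + (sin b)\<^sup>2 > 0" using s by (intro add_pos_nonneg) auto
  have "(k' has_real_derivative - 2 * \<alpha> * b' - 2 * \<beta> *
      (inverse (1 + (sin b / sinh t)\<^sup>2) * ((cos b * b' * sinh t - sin b * (cosh t * \<beta>)) / (sinh t * sinh t)))) (at 0)"
    unfolding k'_def using s by (auto intro!: derivative_eq_intros B' simp: B0)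
  also have "inverse (1 + (sin b / sinh t)\<^sup>2) * ((cos b * b' * sinh t - sin b * (cosh t * \<beta>)) / (sinh t * sinh t))
    = (cos b * b' * sinh t - \<beta> * sin b * cosh t) / ((sinh t)\<^sup>2 + (sin b)\<^sup>2)"
  proof -
    have "1 + (sin b / sinh t)\<^sup>2 = ((sinh t)\<^sup>2 + (sin b)\<^sup>2) / (sinh t)\<^sup>2"
      using s by (simp add: power_divide add_divide_distrib)
    then show ?thesis using s p by (simp add: power2_eq_square mult_ac)
  qed
  finally have k'': "(k' has_real_derivative - 2 * \<alpha> * b' - 2 * \<beta> * ((cos b * b' * sinh t - \<beta> * sin b * cosh t) / ((sinh t)\<^sup>2 + (sin b)\<^sup>2))) (at 0)" .
  show ?thesis using second_difference_limit[OF d k k''] by simp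
qed

lemma sin_strip_angle_pos:
  assumes "\<bar>cosh t * tanh u\<bar> < 1"
  shows "sin (strip_angle u t) > 0"
proof -
  have "sin (strip_angle u t) = sqrt (1 - (cosh t * tanh u)\<^sup>2)"
    using assms unfolding strip_angle_def by (simp add: sin_arccos)
  moreover have "(cosh t * tanh u)\<^sup>2 < 1" using assms by (simp add: abs_square_less_1)
  ultimately show ?thesis by simp
qed

text \<open>The second derivative of \<open>strip_mean\<close> in \<open>u\<close>, that is, -2
  times the u-derivative of the strip angle.\<close>

definition strip_density :: "real \<Rightarrow> real \<Rightarrow> real" where
  "strip_density u t = 2 * cosh t / ((cosh u)\<^sup>2 * sin (strip_angle u t))"

lemma strip_density_pos: "\<bar>cosh t * tanh u\<bar> < 1 \<Longrightarrow> strip_density u t > 0"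
  unfolding strip_density_def using sin_strip_angle_pos[of t u] by simp

lemma strip_mean_second_difference_horizontal:
  assumes "t > 0" "\<bar>cosh t * tanh u\<bar> < 1"
  shows "((\<lambda>h. (strip_mean (u + \<alpha> * h) t + strip_mean (u - \<alpha> * h) t - 2 * strip_mean u t) / h\<^sup>2)
    \<longlongrightarrow> \<alpha>\<^sup>2 * strip_density u t) (at_right 0)"
  using strip_mean_second_difference[OF assms, of \<alpha> 0]
  by (simp add: strip_density_def power2_eq_square mult_ac)

text \<open>The slope \<open>\<xi>\<close> is the one along which the angle is stationary; the product of the two limits
  (for unit \<open>\<alpha>\<close> and \<open>\<beta>\<close>) is 4, the Monge-Ampere determinant of the comparison function.\<close>

lemma strip_mean_second_difference_oblique:
  assumes "t > 0" "\<bar>cosh t * tanh u\<bar> < 1"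
  defines "\<xi> \<equiv> - (tanh t * sinh u * cosh u)"
  shows "((\<lambda>h. (strip_mean (u + \<beta> * \<xi> * h) (t + \<beta> * h) + strip_mean (u - \<beta> * \<xi> * h) (t - \<beta> * h) - 2 * strip_mean u t) / h\<^sup>2)
    \<longlongrightarrow> \<beta>\<^sup>2 * 4 / strip_density u t) (at_right 0)"
proof -
  define b where "b = strip_angle u t"
  have sb: "sin b > 0" unfolding b_def using sin_strip_angle_pos assms by blast
  have cb: "cos b = cosh t * tanh u" unfolding b_def cos_strip_angle using assms by simp
  have z: "\<beta> * sinh t * tanh u + \<beta> * \<xi> * cosh t / (cosh u)\<^sup>2 = 0"
    unfolding \<xi>_def tanh_def by (simp add: field_simps power2_eq_square)
  have "(sinh t)\<^sup>2 + (sin b)\<^sup>2 = (cosh t)\<^sup>2 / (cosh u)\<^sup>2"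
  proof -
    have "(sinh t)\<^sup>2 + (sin b)\<^sup>2 = (cosh t)\<^sup>2 - (cos b)\<^sup>2"
      using cosh_square_eq[of t] sin_cos_squared_add[of b] by linarith
    also have "\<dots> = (cosh t)\<^sup>2 * ((cosh u)\<^sup>2 - (sinh u)\<^sup>2) / (cosh u)\<^sup>2"
      unfolding cb tanh_def by (simp add: field_simps power2_eq_square)
    finally show ?thesis by (simp add: hyperbolic_pythagoras)
  qed
  note e = this
  have "2 * \<beta> * (\<beta> * sin b * cosh t / ((sinh t)\<^sup>2 + (sin b)\<^sup>2)) = \<beta>\<^sup>2 * 4 / strip_density u t"
    using sb unfolding e strip_density_def b_def[symmetric] by (simp add: field_simps power2_eq_square)
  then show ?thesis
    using strip_mean_second_difference[OF assms(1,2), of "\<beta> * \<xi>" \<beta>]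
    unfolding z b_def[symmetric] by simp
qed

section \<open>Jensen's formula and valence\<close>

lemma circle_mean_holomorphic:
  fixes f :: "complex \<Rightarrow> complex"
  assumes "f holomorphic_on ball 0 R" "0 < \<rho>" "\<rho> < R"
  shows "((\<lambda>\<phi>. f (of_real \<rho> * cis \<phi>)) has_integral of_real (2 * pi) * f 0) {0..2*pi}"
proof -
  have "((\<lambda>u. f u / (u - 0)) has_contour_integral (2 * of_real pi * \<i> * f 0)) (circlepath 0 \<rho>)"
    using assms by (intro Cauchy_integral_circlepath_simple) (auto intro: holomorphic_on_subset)
  then have "((\<lambda>t. f (0 + \<rho> * cis t) / (0 + \<rho> * cis t - 0) * \<rho> * \<i> * cis t) has_integral (2 * of_real pi * \<i> * f 0)) {0..2*pi}"
    unfolding circlepath_def by (subst (asm) has_contour_integral_part_circlepath_iff) auto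
  then have "((\<lambda>t. \<i> * f (\<rho> * cis t)) has_integral (2 * of_real pi * \<i> * f 0)) {0..2*pi}"
    using assms by (simp add: mult_ac)
  from has_integral_mult_right[OF this, of "- \<i>"]
  show ?thesis by (simp add: mult.assoc[symmetric]) (simp add: mult_ac)
qed

lemma circle_mean_ln:
  assumes "f holomorphic_on ball 0 R" "\<And>z. z \<in> ball 0 R \<Longrightarrow> f z \<noteq> 0" "0 < \<rho>" "\<rho> < R"
  shows "((\<lambda>\<phi>. ln (cmod (f (of_real \<rho> * cis \<phi>)))) has_integral 2 * pi * ln (cmod (f 0))) {0..2*pi}"
proof -
  obtain L where L: "L holomorphic_on ball 0 R" "\<And>z. z \<in> ball 0 R \<Longrightarrow> f z = exp (L z)"
    using contractible_imp_holomorphic_log[OF assms(1) _ assms(2)] convex_imp_contractible[of "ball 0 R"]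
    by (metis convex_ball)
  have "((\<lambda>\<phi>. Re (L (of_real \<rho> * cis \<phi>))) has_integral Re (of_real (2 * pi) * L 0)) {0..2*pi}"
    using has_integral_linear[OF circle_mean_holomorphic[OF L(1) assms(3,4)] bounded_linear_Re] by (simp add: o_def)
  moreover have "Re (L z) = ln (cmod (f z))" if "z \<in> ball 0 R" for z
    using L(2)[OF that] by simp
  ultimately show ?thesis
    using assms by (simp add: norm_mult)
qed

text \<open>The logarithms to be averaged may be singular on the circle and depend on a second
  angle; a finite measure makes monotone convergence and Fubini available for them.\<close>

abbreviation circle_measure :: "real measure" where
  "circle_measure \<equiv> restrict_space lborel {0..2*pi}"

lemma finite_measure_circle: "finite_measure circle_measure"
  by (intro finite_measureI) (simp add: emeasure_restrict_space)

lemma circle_integral_continuous: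
  fixes f :: "real \<Rightarrow> real"
  assumes "continuous_on {0..2*pi} f"
  shows "integrable circle_measure f" "integral\<^sup>L circle_measure f = integral {0..2*pi} f"
proof -
  have "set_integrable lborel {0..2*pi} f" using assms by (rule borel_integrable_atLeastAtMost')
  then show "integrable circle_measure f" "integral\<^sup>L circle_measure f = integral {0..2*pi} f"
    using set_borel_integral_eq_integral(2)[of "{0..2*pi}" f]
    by (auto simp: integrable_restrict_space integral_restrict_space set_integrable_def set_lebesgue_integral_def)
qed

lemma AE_circle_neq: "\<rho> > 0 \<Longrightarrow> AE \<phi> in circle_measure. of_real \<rho> * cis \<phi> \<noteq> a"
proof -
  assume \<rho>: "\<rho> > 0"
  have "finite {\<phi> \<in> {0..2*pi}. of_real \<rho> * cis \<phi> = a}"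
  proof (cases "{\<phi> \<in> {0..2*pi}. of_real \<rho> * cis \<phi> = a} = {}")
    case False
    then obtain \<psi> where \<psi>: "\<psi> \<in> {0..2*pi}" "of_real \<rho> * cis \<psi> = a" by blast
    have "{\<phi> \<in> {0..2*pi}. of_real \<rho> * cis \<phi> = a} \<subseteq> {\<psi>, \<psi> - 2 * pi, \<psi> + 2 * pi}"
    proof
      fix \<phi> assume "\<phi> \<in> {\<phi> \<in> {0..2*pi}. of_real \<rho> * cis \<phi> = a}"
      then have \<phi>: "\<phi> \<in> {0..2*pi}" "cis \<phi> = cis \<psi>" using \<psi>(2) \<rho> by auto
      then have "cis (\<phi> - \<psi>) = 1" by (simp flip: cis_divide)
      then have "cos (\<phi> - \<psi>) = 1" by (simp add: complex_eq_iff)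
      then obtain n :: int where n: "\<phi> - \<psi> = real_of_int n * 2 * pi" using cos_one_2pi_int by blast
      have "\<bar>\<phi> - \<psi>\<bar> \<le> 2 * pi" using \<phi>(1) \<psi>(1) by auto
      then have "\<bar>real_of_int n\<bar> * (2 * pi) \<le> 1 * (2 * pi)"
        unfolding n by (simp add: abs_mult)
      then have "\<bar>real_of_int n\<bar> \<le> 1" by (rule mult_right_le_imp_le) simp
      then have "\<bar>n\<bar> \<le> 1" by simp
      then have "n = 0 \<or> n = 1 \<or> n = -1" by arith
      then show "\<phi> \<in> {\<psi>, \<psi> - 2 * pi, \<psi> + 2 * pi}" using n by auto
    qed
    then show ?thesis by (rule finite_subset) auto
  next
    case True
    then show ?thesis by (simp only: finite.emptyI)
  qed
  then have "AE \<phi> in lborel. \<phi> \<notin> {\<phi> \<in> {0..2*pi}. of_real \<rho> * cis \<phi> = a}"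
    using finite_imp_null_set_lborel AE_not_in by blast
  then show ?thesis
    by (subst AE_restrict_space_iff) (auto elim!: eventually_mono)
qed

text \<open>For \<open>a\<close> outside the circle, z - a is itself free of zeros in a disc
  containing it. For \<open>a\<close> inside, conjugation on the unit circle exchanges it for \<rho>
  - cnj a * z, which has the same modulus there and no zero in the closed unit disc.\<close>

lemma circle_log_distance_off_circle:
  assumes "\<rho> > 0" "cmod a \<noteq> \<rho>"
  shows "((\<lambda>\<phi>. ln (cmod (of_real \<rho> * cis \<phi> - a))) has_integral 2 * pi * ln (max \<rho> (cmod a))) {0..2*pi}"
proof (cases "cmod a < \<rho>")
  case True
  \<comment> \<open>The zero of \<rho> - cnj a * z has modulus \<rho> / |a|; for
    \<open>a = 0\<close> there is none and any radius above 1 serves.\<close>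
  define R where "R = (if a = 0 then 2 else \<rho> / cmod a)"
  have R: "1 < R" using True by (simp add: R_def)
  have nz: "of_real \<rho> - cnj a * z \<noteq> 0" if "z \<in> ball 0 R" for z
  proof
    assume "of_real \<rho> - cnj a * z = 0"
    then have "cmod (of_real \<rho>) = cmod a * cmod z" by (metis complex_mod_cnj eq_iff_diff_eq_0 norm_mult)
    then show False using that assms(1) by (auto simp: R_def split: if_splits simp: field_simps)
  qed
  have "((\<lambda>\<phi>. ln (cmod (of_real \<rho> - cnj a * (of_real 1 * cis \<phi>)))) has_integral 2 * pi * ln (cmod (of_real \<rho> - cnj a * 0))) {0..2*pi}"
    by (rule circle_mean_ln[of _ R]) (use R nz in \<open>auto intro!: holomorphic_intros\<close>)
  moreover have "cmod (of_real \<rho> - cnj a * (of_real 1 * cis \<phi>)) = cmod (of_real \<rho> * cis \<phi> - a)" for \<phi>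
  proof -
    have "cmod (of_real \<rho> * cis \<phi> - a) = cmod (cis \<phi> * cnj (of_real \<rho> - cnj a * cis \<phi>))"
      by (simp add: algebra_simps cis_cnj cis_mult flip: mult.assoc)
    then show ?thesis by (simp add: norm_mult del: complex_cnj_diff)
  qed
  ultimately show ?thesis using True assms(1) by simp
next
  case False
  have "((\<lambda>\<phi>. ln (cmod (of_real \<rho> * cis \<phi> - a))) has_integral 2 * pi * ln (cmod (0 - a))) {0..2*pi}"
    by (rule circle_mean_ln[of "\<lambda>z. z - a" "cmod a"]) (use assms False in \<open>auto intro!: holomorphic_intros\<close>)
  then show ?thesis using False assms by simp
qed

text \<open>A point on the circle is approached radially from outside by \<open>s n * a\<close>. The
  distance from any point of the circle to these decreases with \<open>n\<close>, so monotone
  convergence carries over the formula for points off the circle.\<close>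

lemma circle_log_distance:
  assumes "\<rho> > 0"
  shows "integrable circle_measure (\<lambda>\<phi>. ln (cmod (of_real \<rho> * cis \<phi> - a)))"
    "integral\<^sup>L circle_measure (\<lambda>\<phi>. ln (cmod (of_real \<rho> * cis \<phi> - a))) = 2 * pi * ln (max \<rho> (cmod a))"
proof -
  have off: "integrable circle_measure (\<lambda>\<phi>. ln (cmod (of_real \<rho> * cis \<phi> - a))) \<and>
    integral\<^sup>L circle_measure (\<lambda>\<phi>. ln (cmod (of_real \<rho> * cis \<phi> - a))) = 2 * pi * ln (max \<rho> (cmod a))"
    if "cmod a \<noteq> \<rho>" for a
  proof -
    have "continuous_on {0..2*pi} (\<lambda>\<phi>. ln (cmod (of_real \<rho> * cis \<phi> - a)))"
      using that assms by (intro continuous_intros) (auto simp: norm_mult)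
    from circle_integral_continuous[OF this] show ?thesis
      using circle_log_distance_off_circle[OF assms that] by (simp add: integral_unique)
  qed
  have "integrable circle_measure (\<lambda>\<phi>. ln (cmod (of_real \<rho> * cis \<phi> - a))) \<and>
    integral\<^sup>L circle_measure (\<lambda>\<phi>. ln (cmod (of_real \<rho> * cis \<phi> - a))) = 2 * pi * ln (max \<rho> (cmod a))"
  proof (cases "cmod a = \<rho>")
    case True
    define s where "s = (\<lambda>n. 1 + inverse (real (Suc n)))"
    have s1: "s n > 1" for n by (simp add: s_def)
    have slim: "s \<longlonglongrightarrow> 1" unfolding s_def by (rule LIMSEQ_inverse_real_of_nat_add)
    have smono: "s n \<le> s m" if "m \<le> n" for m n using that by (simp add: s_def le_imp_inverse_le)
    define f where "f = (\<lambda>n \<phi>. - ln (cmod (of_real \<rho> * cis \<phi> - of_real (s n) * a)))"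
    have cs: "cmod (of_real (s n) * a) = s n * \<rho>" for n using s1[of n] True by (simp add: norm_mult)
    have ne: "cmod (of_real (s n) * a) \<noteq> \<rho>" for n unfolding cs using s1[of n] assms by simp
    have int: "integrable circle_measure (f n)" "integral\<^sup>L circle_measure (f n) = - (2 * pi * ln (s n * \<rho>))" for n
      unfolding f_def using off[OF ne[of n]] s1[of n] assms by (auto simp: cs max_def)
    have mono_dist: "cmod (z - of_real r * a) \<le> cmod (z - of_real r' * a)" if "cmod z = \<rho>" "1 \<le> r" "r \<le> r'" for z r r'
    proof -
      have e: "(cmod (z - of_real r * a))\<^sup>2 = \<rho>\<^sup>2 * (1 + r\<^sup>2) - 2 * r * Re (z * cnj a)" for r
      proof -
        have "(Re z)\<^sup>2 + (Im z)\<^sup>2 = \<rho>\<^sup>2" "(Re a)\<^sup>2 + (Im a)\<^sup>2 = \<rho>\<^sup>2"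
          using True that(1) by (simp_all flip: cmod_power2)
        then show ?thesis by (simp add: cmod_power2) algebra
      qed
      have "Re (z * cnj a) \<le> \<rho>\<^sup>2"
        using complex_Re_le_cmod[of "z * cnj a"] True that(1) by (simp add: norm_mult power2_eq_square)
      then have "2 * (r' - r) * Re (z * cnj a) \<le> (r' + r) * (r' - r) * \<rho>\<^sup>2"
        using that by (intro order.trans[OF mult_left_mono mult_right_mono]) auto
      then have "(cmod (z - of_real r * a))\<^sup>2 \<le> (cmod (z - of_real r' * a))\<^sup>2"
        unfolding e by (simp add: algebra_simps power2_eq_square)
      then show ?thesis by (rule power2_le_imp_le) simp
    qed
    have pos: "0 < cmod (of_real \<rho> * cis \<phi> - of_real (s n) * a)" for n \<phi>
    proof -
      have "cmod (of_real \<rho> * cis \<phi>) = \<rho>" using assms by (simp add: norm_mult)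
      then show ?thesis using ne[of n] by (metis eq_iff_diff_eq_0 zero_less_norm_iff)
    qed
    have "f m \<phi> \<le> f n \<phi>" if "m \<le> n" for m n \<phi>
    proof -
      have "cmod (of_real \<rho> * cis \<phi> - of_real (s n) * a) \<le> cmod (of_real \<rho> * cis \<phi> - of_real (s m) * a)"
        using assms s1[of n] smono[OF that] by (intro mono_dist) (simp_all add: norm_mult)
      then show ?thesis unfolding f_def using pos[of \<phi>] by simp
    qed
    then have 1: "AE \<phi> in circle_measure. mono (\<lambda>n. f n \<phi>)"
      by (intro always_eventually allI monoI)
    have 2: "AE \<phi> in circle_measure. (\<lambda>n. f n \<phi>) \<longlonglongrightarrow> - ln (cmod (of_real \<rho> * cis \<phi> - a))"
      using AE_circle_neq[OF assms, of a]
    proof eventually_elim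
      case (elim \<phi>)
      have "(\<lambda>n. f n \<phi>) \<longlonglongrightarrow> - ln (cmod (of_real \<rho> * cis \<phi> - of_real 1 * a))"
        unfolding f_def by (intro tendsto_intros slim) (use elim in auto)
      then show ?case by simp
    qed
    have 3: "(\<lambda>n. integral\<^sup>L circle_measure (f n)) \<longlonglongrightarrow> - (2 * pi * ln (1 * \<rho>))"
      unfolding int by (intro tendsto_intros slim) (use assms in auto)
    have meas: "(\<lambda>\<phi>. - ln (cmod (of_real \<rho> * cis \<phi> - a))) \<in> borel_measurable circle_measure"
    proof -
      have "(\<lambda>\<phi>. cmod (of_real \<rho> * cis \<phi> - a)) \<in> borel_measurable borel"
        by (intro borel_measurable_continuous_onI continuous_intros)
      then show ?thesis by (intro measurable_restrict_space1) simp
    qed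
    show ?thesis
      using Bochner_Integration.integrable_minus[OF integrable_monotone_convergence[OF int(1) 1 2 3 meas]]
        integral_monotone_convergence[OF int(1) 1 2 3 meas] True
      by simp
  qed (use off in blast)
  then show "integrable circle_measure (\<lambda>\<phi>. ln (cmod (of_real \<rho> * cis \<phi> - a)))"
    "integral\<^sup>L circle_measure (\<lambda>\<phi>. ln (cmod (of_real \<rho> * cis \<phi> - a))) = 2 * pi * ln (max \<rho> (cmod a))" by auto
qed

lemma continuous_on_circle:
  fixes f :: "complex \<Rightarrow> 'a::topological_space"
  assumes "continuous_on (ball 0 1) f" "0 < \<rho>" "\<rho> < 1"
  shows "continuous_on S (\<lambda>\<phi>. f (of_real \<rho> * cis \<phi>))"
  by (rule continuous_on_compose2[OF assms(1)])
     (use assms(2,3) in \<open>auto intro!: continuous_intros simp: norm_mult\<close>)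

lemma borel_measurable_circle:
  fixes f :: "complex \<Rightarrow> complex"
  assumes "continuous_on (ball 0 1) f" "0 < \<rho>" "\<rho> < 1"
  shows "(\<lambda>\<phi>. f (of_real \<rho> * cis \<phi>)) \<in> borel_measurable circle_measure"
  by (intro measurable_restrict_space1)
     (auto intro!: borel_measurable_continuous_onI continuous_on_circle assms)

lemma jensen_finite_zeros:
  fixes q Q :: "complex \<Rightarrow> complex"
  assumes q: "continuous_on (ball 0 1) q"
    and Q: "Q holomorphic_on ball 0 1" "\<And>z. z \<in> ball 0 1 \<Longrightarrow> Q z \<noteq> 0"
    and Z: "finite Z" "\<And>z. z \<in> ball 0 1 \<Longrightarrow> q z = (\<Prod>w\<in>Z. (z - w) ^ m w) * Q z"
    and \<rho>: "0 < \<rho>" "\<rho> < 1"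
  shows "integral\<^sup>L circle_measure (\<lambda>\<phi>. ln (cmod (q (of_real \<rho> * cis \<phi>)))) =
       2 * pi * ((\<Sum>w\<in>Z. real (m w) * ln (max \<rho> (cmod w))) + ln (cmod (Q 0)))"
proof -
  define z where "z = (\<lambda>\<phi>. of_real \<rho> * cis \<phi> :: complex)"
  have zb: "z \<phi> \<in> ball 0 1" for \<phi> using \<rho> by (simp add: z_def norm_mult)
  define F where "F = (\<lambda>\<phi>. (\<Sum>w\<in>Z. real (m w) * ln (cmod (z \<phi> - w))) + ln (cmod (Q (z \<phi>))))"
  \<comment> \<open>Zeros on the circle itself are allowed, and \<open>ln 0 = 0\<close> would spoil
    the splitting of the logarithm there; only finitely many angles are affected.\<close>
  have "AE \<phi> in circle_measure. \<forall>w\<in>Z. z \<phi> \<noteq> w"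
    unfolding z_def using Z(1) by (intro AE_finite_allI AE_circle_neq \<rho>)
  then have ae: "AE \<phi> in circle_measure. ln (cmod (q (z \<phi>))) = F \<phi>"
  proof eventually_elim
    case (elim \<phi>)
    have "cmod (q (z \<phi>)) = (\<Prod>w\<in>Z. cmod (z \<phi> - w) ^ m w) * cmod (Q (z \<phi>))"
      using Z(2)[OF zb] by (simp add: norm_mult norm_power flip: prod_norm)
    also have "ln \<dots> = ln (\<Prod>w\<in>Z. cmod (z \<phi> - w) ^ m w) + ln (cmod (Q (z \<phi>)))"
      using elim Q(2)[OF zb] Z(1) by (intro ln_mult_pos prod_pos) auto
    also have "ln (\<Prod>w\<in>Z. cmod (z \<phi> - w) ^ m w) = (\<Sum>w\<in>Z. ln (cmod (z \<phi> - w) ^ m w))"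
      using elim Z(1) by (intro ln_prod) auto
    also have "\<dots> = (\<Sum>w\<in>Z. real (m w) * ln (cmod (z \<phi> - w)))"
      using elim by (intro sum.cong) (auto simp: ln_realpow)
    finally show ?case by (simp add: F_def)
  qed
  have contQ: "continuous_on {0..2*pi} (\<lambda>\<phi>. ln (cmod (Q (z \<phi>))))"
    unfolding z_def using zb Q
    by (intro continuous_intros continuous_on_circle \<rho> holomorphic_on_imp_continuous_on) (auto simp: z_def)
  note intQ = circle_integral_continuous[OF contQ]
  have "integral {0..2*pi} (\<lambda>\<phi>. ln (cmod (Q (z \<phi>)))) = 2 * pi * ln (cmod (Q 0))"
    unfolding z_def using circle_mean_ln[OF Q \<rho>] by (rule integral_unique)
  note intQ = intQ(1) intQ(2)[unfolded this]
  have intZ: "integrable circle_measure (\<lambda>\<phi>. ln (cmod (z \<phi> - w)))"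
    "integral\<^sup>L circle_measure (\<lambda>\<phi>. ln (cmod (z \<phi> - w))) = 2 * pi * ln (max \<rho> (cmod w))" for w
    unfolding z_def by (rule circle_log_distance[OF \<rho>(1)])+
  have F: "integrable circle_measure F" "integral\<^sup>L circle_measure F =
       2 * pi * ((\<Sum>w\<in>Z. real (m w) * ln (max \<rho> (cmod w))) + ln (cmod (Q 0)))"
    unfolding F_def using intQ intZ
    by (simp_all add: Bochner_Integration.integral_sum sum_distrib_left algebra_simps)
  have meas: "(\<lambda>\<phi>. ln (cmod (q (z \<phi>)))) \<in> borel_measurable circle_measure"
    using borel_measurable_circle[OF q \<rho>] unfolding z_def by measurable
  show "integral\<^sup>L circle_measure (\<lambda>\<phi>. ln (cmod (q (of_real \<rho> * cis \<phi>)))) =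
       2 * pi * ((\<Sum>w\<in>Z. real (m w) * ln (max \<rho> (cmod w))) + ln (cmod (Q 0)))"
    using integral_cong_AE[OF meas borel_measurable_integrable[OF F(1)] ae] F(2) by (simp add: z_def)
qed

text \<open>In Jensen's formula each zero contributes \<open>ln (max \<rho> (cmod w))\<close>, which
  as a function of ln \<rho> has slope at most 1; the total slope is thus at most the number of
  zeros.\<close>

lemma jensen_growth:
  fixes q Q :: "complex \<Rightarrow> complex"
  assumes q: "continuous_on (ball 0 1) q"
    and Q: "Q holomorphic_on ball 0 1" "\<And>z. z \<in> ball 0 1 \<Longrightarrow> Q z \<noteq> 0"
    and Z: "finite Z" "\<And>z. z \<in> ball 0 1 \<Longrightarrow> q z = (\<Prod>w\<in>Z. (z - w) ^ m w) * Q z"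
    and p: "sum m Z \<le> p"
    and \<rho>: "0 < \<rho>'" "\<rho>' < \<rho>" "\<rho> < 1"
  shows "integral\<^sup>L circle_measure (\<lambda>\<phi>. ln (cmod (q (of_real \<rho> * cis \<phi>)))) \<le>
    integral\<^sup>L circle_measure (\<lambda>\<phi>. ln (cmod (q (of_real \<rho>' * cis \<phi>)))) + 2 * pi * p * ln (\<rho> / \<rho>')"
proof -
  have "ln (max \<rho> x) \<le> ln (max \<rho>' x) + ln (\<rho> / \<rho>')" for x
  proof -
    have "max \<rho> x \<le> max \<rho>' x * (\<rho> / \<rho>')"
    proof (cases "x \<le> \<rho>")
      case True
      have "\<rho> = \<rho>' * (\<rho> / \<rho>')" using \<rho> by simp
      also have "\<dots> \<le> max \<rho>' x * (\<rho> / \<rho>')" using \<rho> by (intro mult_right_mono) auto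
      finally show ?thesis using True by simp
    next
      case False
      then have "x * 1 \<le> x * (\<rho> / \<rho>')" using \<rho> by (intro mult_left_mono) auto
      then show ?thesis using False \<rho> by simp
    qed
    then have "ln (max \<rho> x) \<le> ln (max \<rho>' x * (\<rho> / \<rho>'))" using \<rho> by (subst ln_le_cancel_iff) auto
    then show ?thesis using \<rho> by (subst (asm) ln_mult_pos) auto
  qed
  then have "(\<Sum>w\<in>Z. real (m w) * ln (max \<rho> (cmod w))) \<le> (\<Sum>w\<in>Z. real (m w) * (ln (max \<rho>' (cmod w)) + ln (\<rho> / \<rho>')))"
    by (intro sum_mono mult_left_mono) auto
  also have "\<dots> = (\<Sum>w\<in>Z. real (m w) * ln (max \<rho>' (cmod w))) + real (sum m Z) * ln (\<rho> / \<rho>')"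
    by (simp add: distrib_left sum.distrib sum_distrib_right)
  also have "real (sum m Z) * ln (\<rho> / \<rho>') \<le> p * ln (\<rho> / \<rho>')"
    using p \<rho> by (intro mult_right_mono) (auto simp del: of_nat_sum)
  finally show ?thesis
    using \<rho> mult_left_mono[of _ _ "2 * pi"]
    by (subst (1 2) jensen_finite_zeros[OF q Q Z]) (fastforce simp: distrib_left mult.assoc)+
qed

text \<open>Valence in the shape that Jensen's formula consumes: each g - c is a polynomial of
  degree at most \<open>p\<close> times a zero-free function. In this shape it also passes directly
  to 1 / g.\<close>

definition factors_valent :: "nat \<Rightarrow> (complex \<Rightarrow> complex) \<Rightarrow> bool" where
  "factors_valent p g \<longleftrightarrow> (\<forall>c. \<exists>Z m Q. finite Z \<and> sum m Z \<le> p \<and> Q holomorphic_on ball 0 1 \<and>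
     (\<forall>z\<in>ball 0 1. Q z \<noteq> 0 \<and> g z - c = (\<Prod>w\<in>Z. (z - w) ^ m w) * Q z))"

text \<open>Jensen's formula for \<open>g - e\<^sup>u cis \<eta>\<close>, averaged over \<open>\<eta>\<close>: the mean of
  \<open>ln \<bar>a - e\<^sup>u cis \<eta>\<bar>\<close> is \<open>max u (ln \<bar>a\<bar>)\<close>.\<close>

lemma valent_circle_mean:
  assumes g: "g holomorphic_on ball 0 1" "\<And>z. z \<in> ball 0 1 \<Longrightarrow> g z \<noteq> 0"
    and v: "factors_valent p g"
    and \<rho>: "0 < \<rho>'" "\<rho>' < \<rho>" "\<rho> < 1"
  shows "integral\<^sup>L circle_measure (\<lambda>\<phi>. max u (ln (cmod (g (of_real \<rho> * cis \<phi>))))) \<le>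
    integral\<^sup>L circle_measure (\<lambda>\<phi>. max u (ln (cmod (g (of_real \<rho>' * cis \<phi>))))) + 2 * pi * p * ln (\<rho> / \<rho>')"
proof -
  interpret C: finite_measure circle_measure by (rule finite_measure_circle)
  interpret P: pair_sigma_finite circle_measure circle_measure ..
  have cont: "continuous_on (ball 0 1) g" using g(1) by (rule holomorphic_on_imp_continuous_on)
  have meas: "measure circle_measure {0..2*pi} = 2 * pi"
    by (simp add: measure_restrict_space)
  define F where "F = (\<lambda>\<rho> \<phi> \<eta>. ln (cmod (g (of_real \<rho> * cis \<phi>) - of_real (exp u) * cis \<eta>)))"
  have F_eta: "integrable circle_measure (F \<rho> \<phi>)"
      "integral\<^sup>L circle_measure (F \<rho> \<phi>) = 2 * pi * max u (ln (cmod (g (of_real \<rho> * cis \<phi>))))"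
    if "0 < \<rho>" "\<rho> < 1" for \<rho> \<phi>
  proof -
    have nz: "cmod (g (of_real \<rho> * cis \<phi>)) > 0" using g(2) that by (simp add: norm_mult)
    have "ln (max (exp u) x) = max u (ln x)" if "x > 0" for x :: real
    proof (cases "exp u \<le> x")
      case True
      then have "u \<le> ln x" using that by (simp add: ln_ge_iff)
      then show ?thesis using True by (simp add: max_absorb2)
    next
      case False
      then have "ln x \<le> ln (exp u)" using that by (intro ln_mono) auto
      then show ?thesis using False by (simp add: max_absorb1)
    qed
    with nz show "integrable circle_measure (F \<rho> \<phi>)"
      "integral\<^sup>L circle_measure (F \<rho> \<phi>) = 2 * pi * max u (ln (cmod (g (of_real \<rho> * cis \<phi>))))"
      unfolding F_def using circle_log_distance[of "exp u" "g (of_real \<rho> * cis \<phi>)"]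
      by (simp_all add: norm_minus_commute)
  qed
  have F_pair: "integrable (circle_measure \<Otimes>\<^sub>M circle_measure) (case_prod (F \<rho>))" if r: "0 < \<rho>" "\<rho> < 1" for \<rho>
  proof -
    have [measurable]: "(\<lambda>\<phi>. g (of_real \<rho> * cis \<phi>)) \<in> borel_measurable circle_measure"
      by (rule borel_measurable_circle[OF cont r])
    have [measurable]: "cis \<in> borel_measurable circle_measure"
      by (intro measurable_restrict_space1) (auto intro!: borel_measurable_continuous_onI continuous_intros)
    have m [measurable]: "case_prod (F \<rho>) \<in> borel_measurable (circle_measure \<Otimes>\<^sub>M circle_measure)"
      unfolding F_def by measurable
    have "compact ((\<lambda>\<phi>. g (of_real \<rho> * cis \<phi>)) ` {0..2*pi})"
      by (intro compact_continuous_image continuous_on_circle cont r) auto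
    then have "bounded ((\<lambda>\<phi>. g (of_real \<rho> * cis \<phi>)) ` {0..2*pi})" by (rule compact_imp_bounded)
    then obtain B where B: "\<And>\<phi>. \<phi> \<in> {0..2*pi} \<Longrightarrow> cmod (g (of_real \<rho> * cis \<phi>)) \<le> B"
      unfolding bounded_iff by blast
    \<comment> \<open>The maximum with 0 covers the value \<open>ln 0 = 0\<close> and makes
      \<open>K\<close> nonnegative.\<close>
    define K where "K = max 0 (ln (1 + \<bar>B\<bar> + exp u))"
    have F_le: "F \<rho> \<phi> \<eta> \<le> K" if "\<phi> \<in> {0..2*pi}" for \<phi> \<eta>
    proof -
      have "cmod (g (of_real \<rho> * cis \<phi>) - of_real (exp u) * cis \<eta>) \<le> 1 + \<bar>B\<bar> + exp u"
        using B[OF that] norm_triangle_ineq4[of "g (of_real \<rho> * cis \<phi>)" "of_real (exp u) * cis \<eta>"]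
        by (simp add: norm_mult del: of_real_exp)
      moreover have "ln x \<le> max 0 (ln y)" if "0 \<le> x" "x \<le> y" for x y :: real
        using that by (cases "x = 0") (auto intro: ln_mono simp: le_max_iff_disj)
      ultimately show ?thesis unfolding F_def K_def using norm_ge_zero by blast
    qed
    \<comment> \<open>\<open>F\<close> is not bounded below. From F \<le> K and 0 \<le> K follows
      |F| \<le> 2 K - F, and the mean of \<open>F\<close> in \<eta> is known explicitly, which
      bounds the L1 norm uniformly in \<phi>.\<close>
    have "\<bar>\<integral>\<eta>. norm (F \<rho> \<phi> \<eta>) \<partial>circle_measure\<bar> \<le> 2 * pi * (2 * K) + 2 * pi * \<bar>u\<bar>" if "\<phi> \<in> {0..2*pi}" for \<phi>
    proof -
      have "(\<integral>\<eta>. norm (F \<rho> \<phi> \<eta>) \<partial>circle_measure) \<le> (\<integral>\<eta>. 2 * K - F \<rho> \<phi> \<eta> \<partial>circle_measure)"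
      proof (rule integral_mono)
        fix \<eta>
        have "0 \<le> K" by (simp add: K_def)
        then show "norm (F \<rho> \<phi> \<eta>) \<le> 2 * K - F \<rho> \<phi> \<eta>"
          using F_le[OF that, of \<eta>] unfolding real_norm_def by linarith
      qed (use F_eta(1)[OF r] in auto)
      also have "\<dots> = 2 * pi * (2 * K) - 2 * pi * max u (ln (cmod (g (of_real \<rho> * cis \<phi>))))"
        using F_eta[OF r] by (subst Bochner_Integration.integral_diff) (simp_all add: meas)
      also have "\<dots> \<le> 2 * pi * (2 * K) + 2 * pi * \<bar>u\<bar>"
      proof -
        have "- max u (ln (cmod (g (of_real \<rho> * cis \<phi>)))) \<le> \<bar>u\<bar>" by linarith
        then have "2 * pi * - max u (ln (cmod (g (of_real \<rho> * cis \<phi>)))) \<le> 2 * pi * \<bar>u\<bar>"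
          by (intro mult_left_mono) auto
        then show ?thesis by simp
      qed
      finally show ?thesis by simp
    qed
    then have "integrable circle_measure (\<lambda>\<phi>. \<integral>\<eta>. norm (case_prod (F \<rho>) (\<phi>, \<eta>)) \<partial>circle_measure)"
      by (intro C.integrable_const_bound[where B="2 * pi * (2 * K) + 2 * pi * \<bar>u\<bar>"])
         (auto simp: AE_restrict_space_iff)
    then show ?thesis
      using F_eta(1)[OF r] by (intro P.Fubini_integrable m) auto
  qed
  define I where "I = (\<lambda>\<rho> \<eta>. \<integral>\<phi>. F \<rho> \<phi> \<eta> \<partial>circle_measure)"
  have I_int: "integrable circle_measure (I \<rho>)"
    "integral\<^sup>L circle_measure (I \<rho>) = 2 * pi * (\<integral>\<phi>. max u (ln (cmod (g (of_real \<rho> * cis \<phi>)))) \<partial>circle_measure)"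
    if "0 < \<rho>" "\<rho> < 1" for \<rho>
    using P.integrable_snd[OF F_pair[OF that]] P.Fubini_integral[OF F_pair[OF that]] F_eta[OF that] by (auto simp: I_def)
  have "I \<rho> \<eta> \<le> I \<rho>' \<eta> + 2 * pi * p * ln (\<rho> / \<rho>')" for \<eta>
  proof -
    obtain Z m Q where "finite Z" "sum m Z \<le> p" "Q holomorphic_on ball 0 1"
      "\<And>z. z \<in> ball 0 1 \<Longrightarrow> Q z \<noteq> 0"
      "\<And>z. z \<in> ball 0 1 \<Longrightarrow> g z - of_real (exp u) * cis \<eta> = (\<Prod>w\<in>Z. (z - w) ^ m w) * Q z"
      using v[unfolded factors_valent_def, THEN spec, of "of_real (exp u) * cis \<eta>"] by blast
    then show ?thesis
      unfolding I_def F_def using \<rho>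
      by (intro jensen_growth[of "\<lambda>z. g z - of_real (exp u) * cis \<eta>" Q Z m]) (auto intro!: continuous_intros cont)
  qed
  then have "integral\<^sup>L circle_measure (I \<rho>) \<le> (\<integral>\<eta>. I \<rho>' \<eta> + 2 * pi * p * ln (\<rho> / \<rho>') \<partial>circle_measure)"
    using I_int(1) \<rho> by (intro integral_mono) auto
  also have "\<dots> = integral\<^sup>L circle_measure (I \<rho>') + 2 * pi * (2 * pi * p * ln (\<rho> / \<rho>'))"
    using I_int(1)[of \<rho>'] \<rho> by (simp add: meas)
  finally have "2 * pi * (\<integral>\<phi>. max u (ln (cmod (g (of_real \<rho> * cis \<phi>)))) \<partial>circle_measure) \<le>
      2 * pi * ((\<integral>\<phi>. max u (ln (cmod (g (of_real \<rho>' * cis \<phi>)))) \<partial>circle_measure) + 2 * pi * p * ln (\<rho> / \<rho>'))"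
    using \<rho> by (simp add: I_int(2) distrib_left)
  then show ?thesis by (rule mult_left_le_imp_le) simp
qed

section \<open>The Monge-Ampere inequality for circular means\<close>

lemma has_real_derivative_pos_part_square:
  "((\<lambda>x::real. (max 0 x)\<^sup>2) has_real_derivative 2 * max 0 x) (at x)"
proof -
  consider "x < 0" | "x > 0" | "x = 0" by linarith
  then show ?thesis
  proof cases
    case 1
    have "((\<lambda>x::real. 0) has_real_derivative 2 * max 0 x) (at x)" using 1 by simp
    then show ?thesis
      by (rule has_field_derivative_transform_within_open[where S="{..<0}"]) (use 1 in auto)
  next
    case 2
    have "((\<lambda>x::real. x\<^sup>2) has_real_derivative 2 * max 0 x) (at x)"
      using 2 by (auto intro!: derivative_eq_intros)
    then show ?thesis
      by (rule has_field_derivative_transform_within_open[where S="{0<..}"]) (use 2 in auto)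
  next
    case 3
    have "((\<lambda>y. ((max 0 y)\<^sup>2 - (max 0 0)\<^sup>2) / (y - 0)) \<longlongrightarrow> (0::real)) (at 0)"
    proof (rule Lim_null_comparison[where g="\<lambda>y. \<bar>y\<bar>"])
      have "norm ((max 0 y)\<^sup>2 / y) \<le> \<bar>y\<bar>" for y :: real
        by (cases "y > 0") (auto simp: power2_eq_square max_def)
      then show "eventually (\<lambda>y::real. norm (((max 0 y)\<^sup>2 - (max 0 0)\<^sup>2) / (y - 0)) \<le> \<bar>y\<bar>) (at 0)"
        by simp
    qed (auto intro!: tendsto_eq_intros)
    then show ?thesis using 3 by (simp add: has_field_derivative_iff)
  qed
qed

text \<open>The second difference of the positive part with step \<open>d\<close>; integrated over a
  circle it yields the second difference of \<open>N\<close> in the level.\<close>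

definition tent :: "real \<Rightarrow> real \<Rightarrow> real" where
  "tent d x = max 0 (d - \<bar>x\<bar>)"

text \<open>A continuously differentiable step from 0 to 1 with derivative \<open>tent d x / d\<^sup>2\<close>.\<close>

definition smooth_step :: "real \<Rightarrow> real \<Rightarrow> real" where
  "smooth_step d x = ((max 0 (x + d))\<^sup>2 - 2 * (max 0 x)\<^sup>2 + (max 0 (x - d))\<^sup>2) / (2 * d\<^sup>2)"

lemma tent_nonneg: "0 \<le> tent d x" by (simp add: tent_def)

lemma continuous_on_tent [continuous_intros]:
  "continuous_on S f \<Longrightarrow> continuous_on S (\<lambda>x. tent d (f x))"
  unfolding tent_def by (intro continuous_intros)

lemma tent_second_difference:
  assumes "0 \<le> d"
  shows "tent d x = max 0 (x - d) + max 0 (x + d) - 2 * max 0 x"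
  using assms by (auto simp: tent_def max_def)

lemma smooth_step_deriv:
  assumes "0 < d"
  shows "(smooth_step d has_real_derivative tent d x / d\<^sup>2) (at x)"
proof -
  have s: "((\<lambda>x. (max 0 (x + e))\<^sup>2) has_real_derivative 2 * max 0 (x + e)) (at x)" for e
    using DERIV_shift[of "\<lambda>x. (max 0 x)\<^sup>2" "2 * max 0 (x + e)" x e] has_real_derivative_pos_part_square by blast
  have "(smooth_step d has_real_derivative
      (2 * max 0 (x + d) - 2 * (2 * max 0 (x + 0)) + 2 * max 0 (x + - d)) / (2 * d\<^sup>2)) (at x)"
    unfolding smooth_step_def using s[of d] s[of 0] s[of "- d"]
    by (intro DERIV_cdivide DERIV_add DERIV_diff DERIV_cmult) simp_all
  also have "(2 * max 0 (x + d) - 2 * (2 * max 0 (x + 0)) + 2 * max 0 (x + - d)) / (2 * d\<^sup>2) = tent d x / d\<^sup>2"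
    using assms by (simp add: tent_second_difference field_simps)
  finally show ?thesis .
qed

lemma continuous_on_smooth_step [continuous_intros]:
  "0 < d \<Longrightarrow> continuous_on S f \<Longrightarrow> continuous_on S (\<lambda>x. smooth_step d (f x))"
  unfolding smooth_step_def by (intro continuous_intros) auto

lemma smooth_step_low: "x \<le> - d \<Longrightarrow> 0 < d \<Longrightarrow> smooth_step d x = 0"
  by (simp add: smooth_step_def max_def)

lemma smooth_step_high:
  assumes "d \<le> x" "0 < d"
  shows "smooth_step d x = 1"
proof -
  have "(max 0 (x + d))\<^sup>2 - 2 * (max 0 x)\<^sup>2 + (max 0 (x - d))\<^sup>2 = 2 * d\<^sup>2"
    using assms by (simp add: max_absorb2) (simp add: power2_eq_square algebra_simps)
  then show ?thesis using assms by (simp add: smooth_step_def)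
qed

lemma smooth_step_bounds:
  assumes "0 < d"
  shows "0 \<le> smooth_step d x" "smooth_step d x \<le> 1"
proof -
  have mono: "smooth_step d x \<le> smooth_step d y" if "x \<le> y" for x y
  proof (rule DERIV_nonneg_imp_nondecreasing[OF that])
    fix z
    have "0 \<le> tent d z / d\<^sup>2" using tent_nonneg by simp
    then show "\<exists>D. (smooth_step d has_real_derivative D) (at z) \<and> 0 \<le> D"
      using smooth_step_deriv[OF assms] by blast
  qed
  show "0 \<le> smooth_step d x" using mono[of "min x (- d)" x] smooth_step_low[of "min x (- d)" d] assms by simp
  show "smooth_step d x \<le> 1" using mono[of x "max x d"] smooth_step_high[of d "max x d"] assms by simp
qed

text \<open>With \<open>smooth_step_mult_le\<close> this bounds a second difference of positive
  parts from below by a linear expression: one weight, frozen at the centre, bounds the outer terms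
  from below, and it represents the central term up to a tent supported near the level.\<close>

lemma pos_part_le_smooth_step:
  assumes "0 < d"
  shows "max 0 x \<le> smooth_step d x * x + tent (2 * d) x"
proof -
  note b = smooth_step_bounds[OF assms, of x]
  consider "x \<le> - d" | "d \<le> x" | "0 \<le> x" "x < d" | "- d < x" "x < 0" by linarith
  then show ?thesis
  proof cases
    case 3
    have "0 \<le> smooth_step d x * x" using b 3 by simp
    then show ?thesis using 3 by (simp add: tent_def)
  next
    case 4
    have "1 * x \<le> smooth_step d x * x" using b 4 by (intro mult_right_mono_neg) auto
    moreover have "tent (2 * d) x = 2 * d + x" "max 0 x = 0" using 4 by (auto simp: tent_def)
    ultimately show ?thesis using 4 by linarith
  qed (use assms tent_nonneg[of "2 * d" x] in \<open>simp_all add: smooth_step_low smooth_step_high\<close>)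
qed

lemma smooth_step_mult_le:
  assumes "0 < d"
  shows "smooth_step d x * y \<le> max 0 y"
proof (cases "0 \<le> y")
  case True
  then show ?thesis using mult_right_mono[OF smooth_step_bounds(2)[OF assms] True] by simp
next
  case False
  then show ?thesis using smooth_step_bounds(1)[OF assms, of x] by (simp add: mult_nonneg_nonpos)
qed

text \<open>Where Y > 0 the gain \<open>h\<close> is at least h Y / B. This linear gain is what
  beats the o(h) behaviour of the strip mean at an edge.\<close>

lemma pos_part_integral_growth:
  fixes Y :: "real \<Rightarrow> real"
  assumes Y: "continuous_on {a..b} Y" "\<And>x. x \<in> {a..b} \<Longrightarrow> Y x \<le> B" and "0 < B" "0 \<le> h"
  shows "(1 + h / B) * integral {a..b} (\<lambda>x. max 0 (Y x)) \<le> integral {a..b} (\<lambda>x. max 0 (Y x + h))"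
proof -
  have "(1 + h / B) * max 0 (Y x) \<le> max 0 (Y x + h)" if "x \<in> {a..b}" for x
  proof (cases "0 < Y x")
    case True
    have "h / B * Y x \<le> h / B * B" using Y(2)[OF that] assms(3,4) by (intro mult_left_mono) auto
    then show ?thesis using True assms(3,4) by (simp add: algebra_simps)
  qed (use assms in auto)
  then have "integral {a..b} (\<lambda>x. (1 + h / B) * max 0 (Y x)) \<le> integral {a..b} (\<lambda>x. max 0 (Y x + h))"
    by (intro integral_le) (auto intro!: integrable_continuous_interval continuous_intros Y(1))
  then show ?thesis by simp
qed

text \<open>Cauchy-Schwarz, linearised with parameter \<open>l\<close>, combined with the fact that the step function
  composed with a periodic \<open>U\<close> runs from 0 to 1 and back.\<close>

lemma periodic_step_energy:
  fixes U V A :: "real \<Rightarrow> real"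
  assumes U: "\<And>x. (U has_real_derivative V x) (at x)" and V: "\<And>x. (V has_real_derivative - A x) (at x)"
    and A: "continuous_on {a..b} A"
    and per: "U a = U b" "V a = V b" and d: "0 < d" and l: "0 \<le> l"
    and hi: "x1 \<in> {a..b}" "d \<le> U x1" and lo: "x2 \<in> {a..b}" "U x2 \<le> - d"
  shows "4 * l - l\<^sup>2 * (integral {a..b} (\<lambda>x. tent d (U x)) / d\<^sup>2) \<le> integral {a..b} (\<lambda>x. smooth_step d (U x) * A x)"
proof -
  have ab: "a \<le> b" using hi by auto
  have cU: "continuous_on S U" for S using U by (meson DERIV_continuous_on has_field_derivative_at_within)
  have cV: "continuous_on S V" for S using V by (meson DERIV_continuous_on has_field_derivative_at_within)
  define T where "T = (\<lambda>x. smooth_step d (U x))"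
  define T' where "T' = (\<lambda>x. tent d (U x) / d\<^sup>2)"
  have T'0: "0 \<le> T' x" for x using tent_nonneg by (simp add: T'_def)
  have cT': "continuous_on S T'" for S unfolding T'_def using d by (intro continuous_intros cU) auto
  have dT: "(T has_real_derivative T' x * V x) (at x)" for x
    unfolding T_def T'_def using DERIV_chain2[OF smooth_step_deriv[OF d] U] by simp
  have cT: "continuous_on S T" for S unfolding T_def using d by (intro continuous_intros cU) auto
  \<comment> \<open>Integration by parts: the boundary term vanishes by periodicity, which turns the
    integral of T A into the energy integral of T' V^2.\<close>
  have "((\<lambda>x. T' x * V x * V x + T x * - A x) has_integral T b * V b - T a * V a) {a..b}"
  proof (rule fundamental_theorem_of_calculus[OF ab])
    fix x
    have "((\<lambda>x. T x * V x) has_real_derivative T' x * V x * V x + T x * - A x) (at x within {a..b})"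
      using DERIV_mult[OF dT V, of x] by (auto intro: has_field_derivative_at_within simp: algebra_simps)
    then show "((\<lambda>x. T x * V x) has_vector_derivative T' x * V x * V x + T x * - A x) (at x within {a..b})"
      by (simp add: has_real_derivative_iff_has_vector_derivative)
  qed
  moreover have "T b * V b - T a * V a = 0" using per by (simp add: T_def)
  ultimately have i0: "integral {a..b} (\<lambda>x. T' x * V x * V x + T x * - A x) = 0" by (simp add: integral_unique)
  have int: "f integrable_on {p..q}" if "continuous_on {p..q} f" for f :: "real \<Rightarrow> real" and p q
    using that by (rule integrable_continuous_interval)
  have "integral {a..b} (\<lambda>x. T' x * V x * V x + T x * - A x) =
      integral {a..b} (\<lambda>x. T' x * V x * V x) - integral {a..b} (\<lambda>x. T x * A x)"
    by (subst integral_diff[symmetric]) (auto intro!: int continuous_intros cT cT' cV A)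
  then have eq: "integral {a..b} (\<lambda>x. T x * A x) = integral {a..b} (\<lambda>x. T' x * (V x)\<^sup>2)"
    using i0 by (simp add: power2_eq_square mult.assoc)
  have var: "\<bar>T q - T p\<bar> \<le> integral {p..q} (\<lambda>x. T' x * \<bar>V x\<bar>)" if "p \<le> q" for p q
  proof -
    have "((\<lambda>x. T' x * V x) has_integral T q - T p) {p..q}"
      by (rule fundamental_theorem_of_calculus[OF that])
         (use dT in \<open>auto simp flip: has_real_derivative_iff_has_vector_derivative intro: has_field_derivative_at_within\<close>)
    then have "T q - T p = integral {p..q} (\<lambda>x. T' x * V x)" by (simp add: integral_unique)
    also have "norm \<dots> \<le> integral {p..q} (\<lambda>x. T' x * \<bar>V x\<bar>)"
      by (rule integral_norm_bound_integral) (auto intro!: int continuous_intros cT' cV simp: abs_mult T'0)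
    finally show ?thesis by simp
  qed
  have T1: "T x1 = 1" "T x2 = 0" using hi lo d by (auto simp: T_def smooth_step_high smooth_step_low)
  have comb: "integral {p..q} f + integral {q..r} f = integral {p..r} f" if "p \<le> q" "q \<le> r" "continuous_on {p..r} f" for p q r and f :: "real \<Rightarrow> real"
    using that by (intro Henstock_Kurzweil_Integration.integral_combine int)
  \<comment> \<open>The two points cut the period into the arc between them and its complement,
    which wraps around through \<open>a\<close> and \<open>b\<close>; \<open>T\<close> varies by at
    least 1 on each.\<close>
  define y1 y2 where "y1 = min x1 x2" and "y2 = max x1 x2"
  have y: "a \<le> y1" "y1 \<le> y2" "y2 \<le> b" using hi lo by (auto simp: y1_def y2_def)
  have Ty: "\<bar>T y2 - T y1\<bar> = 1" using T1 by (auto simp: y1_def y2_def min_def max_def)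
  have "T a = T b" using per by (simp add: T_def)
  define f where "f = (\<lambda>x. T' x * \<bar>V x\<bar>)"
  have cf: "continuous_on S f" for S unfolding f_def by (intro continuous_intros cT' cV)
  have "integral {a..b} f = integral {a..y1} f + integral {y1..y2} f + integral {y2..b} f"
    using y by (simp add: comb[OF _ _ cf])
  moreover have "1 \<le> integral {y1..y2} f" using var[OF y(2)] Ty by (simp add: f_def)
  moreover have "1 \<le> integral {a..y1} f + integral {y2..b} f"
    using var[OF y(1)] var[OF y(3)] Ty \<open>T a = T b\<close> unfolding f_def by linarith
  ultimately have tv: "2 \<le> integral {a..b} f" by linarith
  have "integral {a..b} (\<lambda>x. 2 * l * f x - l\<^sup>2 * T' x) \<le> integral {a..b} (\<lambda>x. T' x * (V x)\<^sup>2)"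
  proof (rule integral_le)
    fix x
    have "0 \<le> T' x * (\<bar>V x\<bar> - l)\<^sup>2" using T'0 by simp
    then show "2 * l * f x - l\<^sup>2 * T' x \<le> T' x * (V x)\<^sup>2"
      unfolding f_def power2_diff by (simp add: algebra_simps)
  qed (auto intro!: int continuous_intros cf cT' cV)
  also have "integral {a..b} (\<lambda>x. 2 * l * f x - l\<^sup>2 * T' x) = 2 * l * integral {a..b} f - l\<^sup>2 * integral {a..b} T'"
    by (subst integral_diff) (auto intro!: int continuous_intros cf cT')
  finally have "2 * l * integral {a..b} f - l\<^sup>2 * integral {a..b} T' \<le> integral {a..b} (\<lambda>x. T x * A x)"
    unfolding eq .
  moreover have "2 * l * 2 \<le> 2 * l * integral {a..b} f" using tv l by (intro mult_left_mono) auto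
  moreover have eT': "integral {a..b} T' = integral {a..b} (\<lambda>x. tent d (U x)) / d\<^sup>2"
    unfolding T'_def by simp
  ultimately show ?thesis unfolding T_def eT' by linarith
qed

section \<open>The logarithm in log-polar coordinates\<close>

lemma vertical_deriv:
  assumes "(f has_field_derivative f') (at (Complex x y))"
  shows "((\<lambda>y. f (Complex x y)) has_vector_derivative \<i> * f') (at y)"
proof -
  have "((\<lambda>y. Complex x y) has_vector_derivative \<i>) (at y)"
  proof -
    have "((\<lambda>y. of_real x + \<i> * of_real y) has_vector_derivative \<i> * of_real 1) (at y)"
      by (auto intro!: derivative_eq_intros)
    then show ?thesis by (simp add: Complex_eq)
  qed
  from field_vector_diff_chain_at[OF this assms] show ?thesis by (simp add: o_def)
qed

locale disc_log =
  fixes L :: "complex \<Rightarrow> complex" and r :: real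
  assumes L: "L holomorphic_on ball 0 1" and L0: "L 0 = 0" and r: "0 < r" "r < 1"
begin

text \<open>With \<zeta> = -t + i \<phi>, circles become vertical lines and \<open>U\<close> stays
  harmonic in (t, \<phi>), which it would not be in (radius, angle).\<close>

definition W :: "complex \<Rightarrow> complex" where
  "W \<zeta> = L (of_real r * exp \<zeta>)"

definition U :: "real \<Rightarrow> real \<Rightarrow> real" where
  "U t \<phi> = Re (W (Complex (- t) \<phi>))"

definition N :: "real \<Rightarrow> real \<Rightarrow> real" where
  "N u t = integral {0..2*pi} (\<lambda>\<phi>. max 0 (U t \<phi> - u))"

text \<open>The half-plane that \<zeta> -> r e^\<zeta> maps into the unit disc. As r < 1, it
  contains the line t = 0 in its interior.\<close>

definition H :: "complex set" where
  "H = {\<zeta>. Re \<zeta> < - ln r}"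

lemma open_H: "open H" unfolding H_def by (rule open_halfspace_Re_lt)

lemma in_H: "Re \<zeta> \<le> 0 \<Longrightarrow> \<zeta> \<in> H"
  using r by (simp add: H_def) (smt (verit) ln_less_zero)

lemma W_holo: "W holomorphic_on H"
proof -
  have "cmod (of_real r * exp \<zeta>) < 1" if "\<zeta> \<in> H" for \<zeta>
  proof -
    have "exp (Re \<zeta>) < exp (- ln r)" using that by (simp add: H_def)
    then show ?thesis using r by (simp add: norm_mult exp_minus field_simps)
  qed
  then show ?thesis unfolding W_def
    by (intro holomorphic_on_compose_gen[OF _ L, unfolded o_def] holomorphic_intros) auto
qed

text \<open>This single function is both U_tt and -U_\<phi>\<phi>, so harmonicity is built in;
  \<open>V\<close> below is U_\<phi>.\<close>

definition A :: "real \<Rightarrow> real \<Rightarrow> real" where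
  "A t \<phi> = Re (deriv (deriv W) (Complex (- t) \<phi>))"

definition V :: "real \<Rightarrow> real \<Rightarrow> real" where
  "V t \<phi> = - Im (deriv W (Complex (- t) \<phi>))"

lemma W_deriv: "\<zeta> \<in> H \<Longrightarrow> (W has_field_derivative deriv W \<zeta>) (at \<zeta>)"
  "\<zeta> \<in> H \<Longrightarrow> (deriv W has_field_derivative deriv (deriv W) \<zeta>) (at \<zeta>)"
  using W_holo open_H by (auto intro!: holomorphic_derivI holomorphic_deriv)

lemma U_deriv:
  assumes "0 \<le> t"
  shows "(U t has_real_derivative V t \<phi>) (at \<phi>)" "(V t has_real_derivative - A t \<phi>) (at \<phi>)"
proof -
  have H: "Complex (- t) \<phi> \<in> H" using assms by (intro in_H) simp
  have "((\<lambda>y. Re (W (Complex (- t) y))) has_vector_derivative Re (\<i> * deriv W (Complex (- t) \<phi>))) (at \<phi>)"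
    by (intro bounded_linear.has_vector_derivative[OF bounded_linear_Re] vertical_deriv W_deriv H)
  then show "(U t has_real_derivative V t \<phi>) (at \<phi>)"
    unfolding U_def V_def by (simp add: has_real_derivative_iff_has_vector_derivative)
  have "((\<lambda>y. - Im (deriv W (Complex (- t) y))) has_vector_derivative - Im (\<i> * deriv (deriv W) (Complex (- t) \<phi>))) (at \<phi>)"
    by (intro has_vector_derivative_minus bounded_linear.has_vector_derivative[OF bounded_linear_Im] vertical_deriv W_deriv H)
  then show "(V t has_real_derivative - A t \<phi>) (at \<phi>)"
    unfolding V_def A_def by (simp add: has_real_derivative_iff_has_vector_derivative)
qed

lemma continuous_on_U [continuous_intros]:
  fixes f g :: "'a::topological_space \<Rightarrow> real"
  assumes "continuous_on S f" "continuous_on S g" "\<And>x. x \<in> S \<Longrightarrow> 0 \<le> f x"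
  shows "continuous_on S (\<lambda>x. U (f x) (g x))"
proof -
  have "continuous_on H W" using W_holo by (rule holomorphic_on_imp_continuous_on)
  moreover have "continuous_on S (\<lambda>x. Complex (- f x) (g x))"
    unfolding Complex_eq by (intro continuous_intros assms)
  ultimately have "continuous_on S (\<lambda>x. W (Complex (- f x) (g x)))"
    by (rule continuous_on_compose2) (use assms(3) in \<open>auto intro!: in_H\<close>)
  then show ?thesis unfolding U_def by (intro continuous_intros)
qed

lemma continuous_on_A:
  assumes "0 \<le> t"
  shows "continuous_on S (A t)"
proof -
  have "continuous_on H (deriv (deriv W))"
    using W_holo open_H by (intro holomorphic_on_imp_continuous_on holomorphic_deriv)
  moreover have "continuous_on S (\<lambda>x. Complex (- t) x)"
    unfolding Complex_eq by (intro continuous_intros)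
  ultimately have "continuous_on S (\<lambda>x. deriv (deriv W) (Complex (- t) x))"
    by (rule continuous_on_compose2) (use assms in \<open>auto intro!: in_H\<close>)
  then show ?thesis unfolding A_def by (intro continuous_intros)
qed

lemma W_periodic: "W (\<zeta> + 2 * of_real pi * \<i>) = W \<zeta>"
  by (simp add: W_def exp_add)

lemma periodic:
  assumes "0 \<le> t"
  shows "U t 0 = U t (2 * pi)" "V t 0 = V t (2 * pi)"
proof -
  have e: "Complex (- t) (2 * pi) = Complex (- t) 0 + 2 * of_real pi * \<i>"
    by (simp add: complex_eq_iff)
  show "U t 0 = U t (2 * pi)" unfolding U_def e W_periodic ..
  have "((\<lambda>\<zeta>. W (\<zeta> + 2 * of_real pi * \<i>)) has_field_derivative deriv W (Complex (- t) (2 * pi))) (at (Complex (- t) 0))"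
  proof -
    have "(W has_field_derivative deriv W (Complex (- t) (2 * pi))) (at (Complex (- t) 0 + 2 * of_real pi * \<i>))"
      unfolding e[symmetric] using assms by (intro W_deriv in_H) simp
    then show ?thesis by (simp only: DERIV_shift)
  qed
  then have "deriv W (Complex (- t) 0) = deriv W (Complex (- t) (2 * pi))"
    unfolding W_periodic by (rule DERIV_imp_deriv)
  then show "V t 0 = V t (2 * pi)" unfolding V_def by simp
qed

lemma U_polar: "U t \<phi> = Re (L (of_real (r * exp (- t)) * cis \<phi>))"
proof -
  have "of_real r * exp (Complex (- t) \<phi>) = of_real (r * exp (- t)) * cis \<phi>"
    unfolding exp_eq_polar by simp
  then show ?thesis by (simp only: U_def W_def)
qed

text \<open>Taylor expansion of \<open>W\<close> with its third derivative bounded on a compact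
  rectangle reaching from time 0 to 2 t. The constant is uniform in \<phi>, so the estimate can be
  integrated over the circle.\<close>

lemma second_difference_U:
  assumes t: "0 < t"
  obtains C where "\<And>h \<phi>. 0 \<le> h \<Longrightarrow> h \<le> t \<Longrightarrow> \<phi> \<in> {0..2*pi} \<Longrightarrow>
    \<bar>U (t + h) \<phi> + U (t - h) \<phi> - 2 * U t \<phi> - h\<^sup>2 * A t \<phi>\<bar> \<le> C * h ^ 3"
proof -
  define S where "S = cbox (Complex (- 2 * t) 0) (Complex 0 (2 * pi))"
  have SH: "S \<subseteq> H" using t by (auto simp: S_def in_cbox_complex_iff intro!: in_H)
  have "continuous_on S (deriv (deriv (deriv W)))"
    using W_holo open_H SH
    by (intro continuous_on_subset[OF _ SH] holomorphic_on_imp_continuous_on holomorphic_deriv)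
  then have "bounded (deriv (deriv (deriv W)) ` S)"
    by (intro compact_imp_bounded compact_continuous_image) (auto simp: S_def)
  then obtain B where B: "\<And>\<zeta>. \<zeta> \<in> S \<Longrightarrow> cmod (deriv (deriv (deriv W)) \<zeta>) \<le> B"
    unfolding bounded_iff by blast
  define f where "f = (\<lambda>n. (deriv ^^ n) W)"
  have taylor: "cmod (f 0 z - (\<Sum>i\<le>2. f i w * (z - w) ^ i / fact i)) \<le> B * cmod (z - w) ^ Suc 2 / fact 2"
    if "w \<in> S" "z \<in> S" for w z
  proof (rule complex_Taylor[OF _ _ _ that])
    show "convex S" by (simp add: S_def)
    show "(f i has_field_derivative f (Suc i) x) (at x within S)" if "x \<in> S" "i \<le> 2" for i x
    proof -
      have "(f i has_field_derivative f (Suc i) x) (at x)"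
        unfolding f_def using W_holo open_H SH that(1)
        by (auto intro!: holomorphic_derivI[where S=H] holomorphic_higher_deriv)
      then show ?thesis by (rule has_field_derivative_at_within)
    qed
    show "cmod (f (Suc 2) x) \<le> B" if "x \<in> S" for x
      using B[OF that] by (simp add: f_def numeral_2_eq_2)
  qed
  have f_simps: "f 0 = W" "f 1 = deriv W" "f 2 = deriv (deriv W)" by (auto simp: f_def numeral_2_eq_2)
  show thesis
  proof (rule that[of B])
    fix h \<phi> assume h: "0 \<le> h" "h \<le> t" and \<phi>: "\<phi> \<in> {0..2*pi}"
    define w where "w = Complex (- t) \<phi>"
    have w: "w \<in> S" "Complex (- (t + h)) \<phi> \<in> S" "Complex (- (t - h)) \<phi> \<in> S"
      using h \<phi> t by (auto simp: w_def S_def in_cbox_complex_iff)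
    have e: "Complex (- (t + h)) \<phi> - w = - of_real h" "Complex (- (t - h)) \<phi> - w = of_real h"
      by (auto simp: w_def complex_eq_iff)
    define p where "p = (\<lambda>x. W w + deriv W w * x + deriv (deriv W) w * x\<^sup>2 / 2)"
    have sum2: "(\<Sum>i\<le>2. f i w * x ^ i / fact i) = p x" for x
      unfolding p_def using f_simps by (simp add: numeral_2_eq_2 eval_nat_numeral)
    have 1: "cmod (W (Complex (- (t + h)) \<phi>) - p (- of_real h)) \<le> B * h ^ 3 / 2"
      using taylor[OF w(1,2)] h unfolding e sum2 f_simps by (simp add: eval_nat_numeral)
    have 2: "cmod (W (Complex (- (t - h)) \<phi>) - p (of_real h)) \<le> B * h ^ 3 / 2"
      using taylor[OF w(1,3)] h unfolding e sum2 f_simps by (simp add: eval_nat_numeral)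
    have pp: "p (- of_real h) + p (of_real h) = 2 * W w + deriv (deriv W) w * (of_real h)\<^sup>2"
      by (simp add: p_def)
    have "U (t + h) \<phi> + U (t - h) \<phi> - 2 * U t \<phi> - h\<^sup>2 * A t \<phi> =
      Re ((W (Complex (- (t + h)) \<phi>) - p (- of_real h)) + (W (Complex (- (t - h)) \<phi>) - p (of_real h)))"
      using arg_cong[OF pp, of Re] unfolding U_def A_def w_def by (simp add: power2_eq_square algebra_simps)
    also have "\<bar>\<dots>\<bar> \<le> B * h ^ 3 / 2 + B * h ^ 3 / 2"
      by (rule order_trans[OF abs_Re_le_cmod norm_triangle_mono[OF 1 2]])
    finally show "\<bar>U (t + h) \<phi> + U (t - h) \<phi> - 2 * U t \<phi> - h\<^sup>2 * A t \<phi>\<bar> \<le> B * h ^ 3" by simp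
  qed
qed

lemma U_integrable:
  assumes "0 \<le> t"
  shows "U t integrable_on {0..2*pi}" "(\<lambda>\<phi>. max 0 (U t \<phi> - u)) integrable_on {0..2*pi}"
    "(\<lambda>\<phi>. tent d (U t \<phi> - u)) integrable_on {0..2*pi}"
  using assms by (auto intro!: integrable_continuous_interval continuous_intros)

lemma N_second_difference:
  assumes "0 \<le> t" "0 \<le> d"
  shows "N (u + d) t + N (u - d) t - 2 * N u t = integral {0..2*pi} (\<lambda>\<phi>. tent d (U t \<phi> - u))"
proof -
  have "tent d (U t \<phi> - u) = max 0 (U t \<phi> - (u + d)) + max 0 (U t \<phi> - (u - d)) - 2 * max 0 (U t \<phi> - u)" for \<phi>
    using tent_second_difference[OF assms(2), of "U t \<phi> - u"] by (simp add: algebra_simps)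
  then show ?thesis
    unfolding N_def using U_integrable[OF assms(1)]
    by (simp add: integral_add integral_diff integrable_add integrable_diff)
qed

text \<open>The weak Monge-Ampere inequality. At a maximum of N - M every second difference of
  \<open>N\<close> is at most that of \<open>M\<close>: the one in the level controls the tents by
  \<open>a\<close>, and the one along the slope \<xi>, at most \<open>b\<close> in the limit, is
  bounded below by the energy estimate 4 l - l^2 a.\<close>

lemma interior_max:
  assumes t: "0 < t"
    and max: "\<And>u' t'. 0 \<le> t' \<Longrightarrow> N u' t' - M u' t' \<le> N u t - M u t"
    and hi: "\<phi>1 \<in> {0..2*pi}" "u < U t \<phi>1" and lo: "\<phi>2 \<in> {0..2*pi}" "U t \<phi>2 < u"
    and a: "0 < a"
    and lim1: "((\<lambda>d. (M (u + d) t + M (u - d) t - 2 * M u t) / d\<^sup>2) \<longlongrightarrow> a) (at_right 0)"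
    and lim2: "((\<lambda>h. (M (u + \<xi> * h) (t + h) + M (u - \<xi> * h) (t - h) - 2 * M u t) / h\<^sup>2) \<longlongrightarrow> b) (at_right 0)"
  shows "4 \<le> a * b"
proof -
  define m1 where "m1 = (\<lambda>d. (M (u + d) t + M (u - d) t - 2 * M u t) / d\<^sup>2)"
  define m2 where "m2 = (\<lambda>h. (M (u + \<xi> * h) (t + h) + M (u - \<xi> * h) (t - h) - 2 * M u t) / h\<^sup>2)"
  define I where "I = (\<lambda>d. integral {0..2*pi} (\<lambda>\<phi>. tent d (U t \<phi> - u)))"
  \<comment> \<open>The maximiser of 4 l - l^2 a, with value 4 / a.\<close>
  define l where "l = 2 / a"
  obtain C0 where C0: "\<And>h \<phi>. 0 \<le> h \<Longrightarrow> h \<le> t \<Longrightarrow> \<phi> \<in> {0..2*pi} \<Longrightarrow>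
    \<bar>U (t + h) \<phi> + U (t - h) \<phi> - 2 * U t \<phi> - h\<^sup>2 * A t \<phi>\<bar> \<le> C0 * h ^ 3"
    using second_difference_U[OF t] by blast
  define C where "C = \<bar>C0\<bar>"
  have C: "\<bar>U (t + h) \<phi> + U (t - h) \<phi> - 2 * U t \<phi> - h\<^sup>2 * A t \<phi>\<bar> \<le> C * h ^ 3" "0 \<le> C * h ^ 3"
    if "0 \<le> h" "h \<le> t" "\<phi> \<in> {0..2*pi}" for h \<phi>
  proof -
    have "C0 * h ^ 3 \<le> C * h ^ 3" using that(1) by (intro mult_right_mono) (auto simp: C_def)
    then show "\<bar>U (t + h) \<phi> + U (t - h) \<phi> - 2 * U t \<phi> - h\<^sup>2 * A t \<phi>\<bar> \<le> C * h ^ 3" "0 \<le> C * h ^ 3"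
      using C0[OF that] that(1) by (auto simp: C_def)
  qed
  have I_le: "I d / d\<^sup>2 \<le> m1 d" if "0 < d" for d
  proof -
    have "I d \<le> M (u + d) t + M (u - d) t - 2 * M u t"
      unfolding I_def using N_second_difference[of t d u] max[of t "u + d"] max[of t "u - d"] t that by simp
    then show ?thesis unfolding m1_def by (intro divide_right_mono) auto
  qed
  \<comment> \<open>For widths up to \<open>d0\<close> the step function attains both 0 and 1 on the
    circle.\<close>
  define d0 where "d0 = min (U t \<phi>1 - u) (u - U t \<phi>2)"
  have d0: "0 < d0" using hi lo by (simp add: d0_def)
  \<comment> \<open>The smoothing width is k h. Being proportional to \<open>h\<close>, it makes the
    tent error, after division by h^2, tend to 8 k^2 a; \<open>k\<close> is sent to 0 only after
    \<open>h\<close>.\<close>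
  have main: "4 * l - l\<^sup>2 * m1 (k * h) - 2 * pi * C * h - 8 * k\<^sup>2 * m1 (2 * k * h) \<le> m2 h"
    if k: "0 < k" and h: "0 < h" "h \<le> t" "k * h \<le> d0" for k h
  proof -
    define d where "d = k * h"
    have d: "0 < d" "d \<le> d0" using k h by (auto simp: d_def)
    define T where "T = (\<lambda>\<phi>. smooth_step d (U t \<phi> - u))"
    have cT: "continuous_on {0..2*pi} T" unfolding T_def using d t by (intro continuous_intros) auto
    have cA: "continuous_on {0..2*pi} (A t)" using t by (intro continuous_on_A) auto
    have TA: "4 * l - l\<^sup>2 * (I d / d\<^sup>2) \<le> integral {0..2*pi} (\<lambda>\<phi>. T \<phi> * A t \<phi>)"
      unfolding I_def T_def
    proof (rule periodic_step_energy[where V="V t"])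
      show "((\<lambda>\<phi>. U t \<phi> - u) has_real_derivative V t x) (at x)" for x
        using U_deriv(1)[of t x] t by (auto intro!: derivative_eq_intros)
      show "(V t has_real_derivative - A t x) (at x)" for x using U_deriv(2)[of t x] t by simp
      show "U t 0 - u = U t (2*pi) - u" "V t 0 = V t (2*pi)" using periodic[of t] t by auto
      show "0 \<le> l" using a by (simp add: l_def)
      show "\<phi>1 \<in> {0..2*pi}" "\<phi>2 \<in> {0..2*pi}" by fact+
      show "d \<le> U t \<phi>1 - u" "U t \<phi>2 - u \<le> - d" using d(2) by (auto simp: d0_def)
    qed (use d cA in auto)
    have pw: "h\<^sup>2 * (T \<phi> * A t \<phi>) - C * h ^ 3 - 2 * tent (2 * d) (U t \<phi> - u) \<le>
        max 0 (U (t + h) \<phi> - (u + \<xi> * h)) + max 0 (U (t - h) \<phi> - (u - \<xi> * h)) - 2 * max 0 (U t \<phi> - u)"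
      if "\<phi> \<in> {0..2*pi}" for \<phi>
    proof -
      have 1: "T \<phi> * (U (t + h) \<phi> - (u + \<xi> * h)) \<le> max 0 (U (t + h) \<phi> - (u + \<xi> * h))"
        "T \<phi> * (U (t - h) \<phi> - (u - \<xi> * h)) \<le> max 0 (U (t - h) \<phi> - (u - \<xi> * h))"
        unfolding T_def by (intro smooth_step_mult_le d)+
      have 2: "max 0 (U t \<phi> - u) \<le> T \<phi> * (U t \<phi> - u) + tent (2 * d) (U t \<phi> - u)"
        unfolding T_def by (intro pos_part_le_smooth_step d)
      have T01: "0 \<le> T \<phi>" "T \<phi> \<le> 1" unfolding T_def using smooth_step_bounds d by auto
      have Ch: "\<bar>U (t + h) \<phi> + U (t - h) \<phi> - 2 * U t \<phi> - h\<^sup>2 * A t \<phi>\<bar> \<le> C * h ^ 3" "0 \<le> C * h ^ 3"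
        using C[of h \<phi>] h that by auto
      have "T \<phi> * (h\<^sup>2 * A t \<phi> - (U (t + h) \<phi> + U (t - h) \<phi> - 2 * U t \<phi>)) \<le> T \<phi> * (C * h ^ 3)"
        using T01 Ch by (intro mult_left_mono) auto
      also have "\<dots> \<le> 1 * (C * h ^ 3)" using T01 Ch by (intro mult_right_mono) auto
      finally have 3: "h\<^sup>2 * (T \<phi> * A t \<phi>) - C * h ^ 3 \<le> T \<phi> * U (t + h) \<phi> + T \<phi> * U (t - h) \<phi> - 2 * (T \<phi> * U t \<phi>)"
        by (simp add: algebra_simps)
      \<comment> \<open>The shifts of the level by \<xi> h and -\<xi> h carry the same weight and
        cancel, so the lower bound does not depend on the slope.\<close>
      have 4: "T \<phi> * U (t + h) \<phi> + T \<phi> * U (t - h) \<phi> - 2 * (T \<phi> * U t \<phi>) =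
        T \<phi> * (U (t + h) \<phi> - (u + \<xi> * h)) + T \<phi> * (U (t - h) \<phi> - (u - \<xi> * h)) - 2 * (T \<phi> * (U t \<phi> - u))"
        by (simp add: algebra_simps)
      have "y - 2 * e \<le> n1 + n2 - 2 * n3" if "x1 \<le> n1" "x2 \<le> n2" "n3 \<le> x3 + e" "y \<le> x1 + x2 - 2 * x3"
        for y e n1 n2 n3 x1 x2 x3 :: real using that by linarith
      from this[OF 1 2 3[unfolded 4]] show ?thesis .
    qed
    have int: "(\<lambda>\<phi>. T \<phi> * A t \<phi>) integrable_on {0..2*pi}"
      by (intro integrable_continuous_interval continuous_intros cT cA)
    have "integral {0..2*pi} (\<lambda>\<phi>. h\<^sup>2 * (T \<phi> * A t \<phi>) - C * h ^ 3 - 2 * tent (2 * d) (U t \<phi> - u)) \<le>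
      integral {0..2*pi} (\<lambda>\<phi>. max 0 (U (t + h) \<phi> - (u + \<xi> * h)) + max 0 (U (t - h) \<phi> - (u - \<xi> * h)) - 2 * max 0 (U t \<phi> - u))"
      by (rule integral_le[OF _ _ pw])
         (use h t in \<open>auto intro!: integrable_continuous_interval continuous_intros cT cA\<close>)
    also have "\<dots> = N (u + \<xi> * h) (t + h) + N (u - \<xi> * h) (t - h) - 2 * N u t"
      unfolding N_def using U_integrable h t
      by (simp add: integral_add integral_diff integrable_add integrable_diff)
    also have "\<dots> \<le> M (u + \<xi> * h) (t + h) + M (u - \<xi> * h) (t - h) - 2 * M u t"
      using max[of "t + h" "u + \<xi> * h"] max[of "t - h" "u - \<xi> * h"] h t by simp
    also have "integral {0..2*pi} (\<lambda>\<phi>. h\<^sup>2 * (T \<phi> * A t \<phi>) - C * h ^ 3 - 2 * tent (2 * d) (U t \<phi> - u)) =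
        h\<^sup>2 * integral {0..2*pi} (\<lambda>\<phi>. T \<phi> * A t \<phi>) - 2 * pi * (C * h ^ 3) - 2 * I (2 * d)"
      unfolding I_def
      using integral_unique[OF has_integral_diff[OF has_integral_diff[OF
          has_integral_mult_right[OF integrable_integral[OF int], of "h\<^sup>2"]
          has_integral_const_real[of "C * h ^ 3" 0 "2 * pi"]]
          has_integral_mult_right[OF integrable_integral[OF U_integrable(3)[of t "2 * d" u]], of 2]]] t
      by simp
    finally have "(h\<^sup>2 * integral {0..2*pi} (\<lambda>\<phi>. T \<phi> * A t \<phi>) - 2 * pi * (C * h ^ 3) - 2 * I (2 * d)) / h\<^sup>2 \<le> m2 h"
      unfolding m2_def by (intro divide_right_mono) auto
    moreover have "(h\<^sup>2 * integral {0..2*pi} (\<lambda>\<phi>. T \<phi> * A t \<phi>) - 2 * pi * (C * h ^ 3) - 2 * I (2 * d)) / h\<^sup>2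
      = integral {0..2*pi} (\<lambda>\<phi>. T \<phi> * A t \<phi>) - 2 * pi * C * h - 8 * k\<^sup>2 * (I (2 * d) / (2 * d)\<^sup>2)"
      using h k by (simp add: d_def field_simps power2_eq_square power3_eq_cube)
    moreover have "8 * k\<^sup>2 * (I (2 * d) / (2 * d)\<^sup>2) \<le> 8 * k\<^sup>2 * m1 (2 * d)"
      using I_le[of "2 * d"] d by (intro mult_left_mono) auto
    moreover have "l\<^sup>2 * (I d / d\<^sup>2) \<le> l\<^sup>2 * m1 d"
      using I_le[of d] d by (intro mult_left_mono) auto
    ultimately have "4 * l - l\<^sup>2 * m1 d - 2 * pi * C * h - 8 * k\<^sup>2 * m1 (2 * d) \<le> m2 h"
      using TA by linarith
    then show ?thesis by (simp add: d_def mult.assoc)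
  qed
  have b_ge: "4 * l - l\<^sup>2 * a - 8 * k\<^sup>2 * a \<le> b" if k: "0 < k" for k
  proof (rule tendsto_le[OF _ lim2[folded m2_def]])
    have scale: "((\<lambda>h. m1 (c * h)) \<longlongrightarrow> a) (at_right 0)" if "0 < c" for c
      by (rule filterlim_compose[OF lim1[folded m1_def]])
         (use that in \<open>auto simp: filterlim_at eventually_at_filter intro!: tendsto_eq_intros\<close>)
    have "((\<lambda>h. 4 * l - l\<^sup>2 * m1 (k * h) - 2 * pi * C * h - 8 * k\<^sup>2 * m1 (2 * k * h)) \<longlongrightarrow>
        4 * l - l\<^sup>2 * a - 2 * pi * C * 0 - 8 * k\<^sup>2 * a) (at_right 0)"
      by (intro tendsto_intros scale) (use k in auto)
    then show "((\<lambda>h. 4 * l - l\<^sup>2 * m1 (k * h) - 2 * pi * C * h - 8 * k\<^sup>2 * m1 (2 * k * h)) \<longlongrightarrow>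
        4 * l - l\<^sup>2 * a - 8 * k\<^sup>2 * a) (at_right 0)" by simp
    have "eventually (\<lambda>h. h \<in> {0<..<min t (d0 / k)}) (at_right 0)"
      using t d0 k by (intro eventually_at_right_real) auto
    then show "eventually (\<lambda>h. 4 * l - l\<^sup>2 * m1 (k * h) - 2 * pi * C * h - 8 * k\<^sup>2 * m1 (2 * k * h) \<le> m2 h) (at_right 0)"
      by eventually_elim (rule main[OF k], use k in \<open>auto simp: field_simps\<close>)
  qed auto
  have "4 / a \<le> b"
  proof (rule ccontr)
    assume "\<not> 4 / a \<le> b"
    define e where "e = 4 / a - b"
    have e: "0 < e" using \<open>\<not> 4 / a \<le> b\<close> by (simp add: e_def)
    have "4 * l - l\<^sup>2 * a = 4 / a" using a by (simp add: l_def power2_eq_square)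
    then have "4 / a - 8 * (sqrt (e / (16 * a)))\<^sup>2 * a \<le> b"
      using b_ge[of "sqrt (e / (16 * a))"] e a by simp
    moreover have "8 * (sqrt (e / (16 * a)))\<^sup>2 * a = e / 2" using e a by simp
    ultimately have "4 / a - e / 2 \<le> b" by (simp only:)
    moreover have "4 / a = b + e" by (simp add: e_def)
    ultimately show False using e by linarith
  qed
  then show ?thesis using a by (simp add: pos_divide_le_eq mult.commute)
qed
end

section \<open>Comparison with the strip\<close>

text \<open>\<open>X\<close> stands for a positive mean at an edge level, where the strip mean is 0,
  and \<open>le\<close> for maximality of the difference when the level moves inwards by
  \<open>h\<close>. The gain h X / B would have to be matched by a strip mean of size o(h).\<close>

lemma edge_contradiction:
  assumes s: "0 < s" and v: "1 \<le> cosh s * tanh v" and pos: "0 < q" "0 < B" "0 < X"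
    and le: "\<And>h. 0 < h \<Longrightarrow> (1 + h / B) * X - q * strip_mean (v - h / q) s \<le> X"
  shows False
proof -
  have ang: "X / B \<le> 2 * strip_angle (v - h / q) s" if "0 < h" for h
  proof -
    have "q * strip_mean (v - h / q) s \<le> q * (2 * (h / q) * strip_angle (v - h / q) s)"
      using strip_mean_edge[OF s v, of "h / q"] that pos by (intro mult_left_mono) auto
    then have "h / B * X \<le> 2 * h * strip_angle (v - h / q) s"
      using le[OF that] pos by (simp add: distrib_right)
    then have "h * (X / B) \<le> h * (2 * strip_angle (v - h / q) s)" by (simp add: mult_ac)
    then show ?thesis using that by (rule mult_left_le_imp_le)
  qed
  have "continuous_on UNIV (\<lambda>h. 2 * strip_angle (v - h / q) s)"
    using pos by (intro continuous_intros) auto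
  then have "((\<lambda>h. 2 * strip_angle (v - h / q) s) \<longlongrightarrow> 2 * strip_angle (v - 0 / q) s) (at_right 0)"
    unfolding continuous_on_def by (meson UNIV_I filterlim_mono at_le order_refl subset_UNIV)
  moreover have "strip_angle v s = 0" using v by (simp add: strip_angle_def)
  ultimately have "((\<lambda>h. 2 * strip_angle (v - h / q) s) \<longlongrightarrow> 0) (at_right 0)" by simp
  then have "X / B \<le> 0"
    by (rule tendsto_lowerbound) (auto simp: eventually_at_filter ang)
  then show False using pos by (simp add: field_simps)
qed

text \<open>As \<open>e\<close> decreases to 0, cosh e * tanh v tends to tanh v and sin (strip_angle
  v e) / sinh e tends to infinity, uniformly for |v| \<le> K.\<close>

lemma exists_strip_shift:
  assumes c: "0 < c" "c < 1" and K: "0 < K"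
  obtains e where "0 < e" "\<And>v. \<bar>v\<bar> \<le> K \<Longrightarrow> \<bar>cosh e * tanh v\<bar> < 1 \<and> c * pi / 2 < arctan (sin (strip_angle v e) / sinh e)"
proof -
  define k where "k = tanh K"
  have k: "0 < k" "k < 1" using K by (auto simp: k_def tanh_real_lt_1)
  define m where "m = tan (c * pi / 2)"
  have l1: "((\<lambda>e. cosh e * k) \<longlongrightarrow> cosh 0 * k) (at_right 0)"
    by (intro tendsto_intros)
  have l2: "((\<lambda>e. sqrt (1 - (cosh e * k)\<^sup>2) - m * sinh e) \<longlongrightarrow> sqrt (1 - (cosh 0 * k)\<^sup>2) - m * sinh 0) (at_right 0)"
    by (intro tendsto_intros)
  have "k\<^sup>2 < 1" using k by (simp add: power_less_one_iff)
  then have "eventually (\<lambda>e. 0 < e \<and> cosh e * k < 1 \<and> 0 < sqrt (1 - (cosh e * k)\<^sup>2) - m * sinh e) (at_right 0)"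
    using order_tendstoD(2)[OF l1, of 1] order_tendstoD(1)[OF l2, of 0] k
    by (intro eventually_conj) (auto simp: eventually_at_filter)
  then obtain e where e: "0 < e" "cosh e * k < 1" "0 < sqrt (1 - (cosh e * k)\<^sup>2) - m * sinh e"
    using eventually_happens[of _ "at_right (0::real)"] by auto
  show thesis
  proof (rule that[OF e(1)])
    fix v assume v: "\<bar>v\<bar> \<le> K"
    have "\<bar>tanh v\<bar> \<le> k" using v unfolding k_def by (simp flip: tanh_real_abs)
    then have le: "\<bar>cosh e * tanh v\<bar> \<le> cosh e * k" by (simp add: abs_mult)
    then have lt1: "\<bar>cosh e * tanh v\<bar> < 1" using e by linarith
    have "sin (strip_angle v e) = sqrt (1 - (cosh e * tanh v)\<^sup>2)"
      using lt1 unfolding strip_angle_def by (simp add: sin_arccos)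
    also have "\<dots> \<ge> sqrt (1 - (cosh e * k)\<^sup>2)"
      using power_mono[OF le, of 2] by simp
    finally have "m * sinh e < sin (strip_angle v e)" using e by linarith
    then have "m < sin (strip_angle v e) / sinh e" using e(1) by (simp add: pos_less_divide_eq)
    then have "arctan m < arctan (sin (strip_angle v e) / sinh e)" by (simp add: arctan_less_iff)
    moreover have "arctan m = c * pi / 2"
    proof -
      have "c * pi / 2 < 1 * pi / 2" "0 < c * pi" using c by auto
      then show ?thesis unfolding m_def by (intro arctan_tan) linarith+
    qed
    ultimately show "\<bar>cosh e * tanh v\<bar> < 1 \<and> c * pi / 2 < arctan (sin (strip_angle v e) / sinh e)"
      using lt1 by simp
  qed
qed

section \<open>Bounds for the circular means and the maximum principle\<close>

context disc_log
begin

lemma U_bounded: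
  obtains K where "0 < K" "\<And>t \<phi>. 0 \<le> t \<Longrightarrow> \<bar>U t \<phi>\<bar> \<le> K"
proof -
  have "bounded (L ` cball 0 r)"
    using r L by (intro compact_imp_bounded compact_continuous_image holomorphic_on_imp_continuous_on)
      (auto intro: holomorphic_on_subset)
  then obtain K where K: "0 < K" "\<And>z. z \<in> cball 0 r \<Longrightarrow> cmod (L z) \<le> K"
    unfolding bounded_pos by blast
  have "\<bar>U t \<phi>\<bar> \<le> K" if "0 \<le> t" for t \<phi>
  proof -
    have "r * exp (- t) \<le> r * 1" using that r by (intro mult_left_mono) auto
    then have "cmod (L (of_real (r * exp (- t)) * cis \<phi>)) \<le> K" using r by (intro K) (simp add: norm_mult)
    then show ?thesis unfolding U_polar using abs_Re_le_cmod order_trans by blast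
  qed
  then show thesis using that K by blast
qed

lemma U_small:
  assumes "0 < e"
  obtains T where "0 \<le> T" "\<And>t \<phi>. T \<le> t \<Longrightarrow> \<bar>U t \<phi>\<bar> \<le> e"
proof -
  have "isCont L 0"
    using holomorphic_on_imp_continuous_on[OF L] by (simp add: continuous_on_eq_continuous_at)
  then obtain d where d: "0 < d" "\<And>z. cmod z < d \<Longrightarrow> cmod (L z) < e"
    using assms unfolding continuous_at_eps_delta by (auto simp: L0)
  show thesis
  proof (rule that[of "max 0 (1 - ln d)"])
    fix t \<phi> assume t: "max 0 (1 - ln d) \<le> t"
    have "r * exp (- t) \<le> 1 * exp (- t)" using r by (intro mult_right_mono) auto
    also have "\<dots> < exp (ln d)" using t by simp
    finally have "cmod (L (of_real (r * exp (- t)) * cis \<phi>)) < e"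
      using d r by (intro d) (simp add: norm_mult)
    then show "\<bar>U t \<phi>\<bar> \<le> e" unfolding U_polar using abs_Re_le_cmod order_trans less_imp_le by blast
  qed simp
qed

lemma mean_U:
  assumes "0 \<le> t"
  shows "integral {0..2*pi} (U t) = 0"
proof -
  have "r * exp (- t) \<le> r * 1" using assms r by (intro mult_left_mono) auto
  then have "r * exp (- t) < 1" using r by linarith
  with r have "((\<lambda>\<phi>. L (of_real (r * exp (- t)) * cis \<phi>)) has_integral of_real (2 * pi) * L 0) {0..2*pi}"
    by (intro circle_mean_holomorphic[OF L]) auto
  from has_integral_linear[OF this bounded_linear_Re]
  have "(U t has_integral 0) {0..2*pi}" by (simp add: o_def L0 U_polar[abs_def])
  then show ?thesis by (rule integral_unique)
qed

lemma N_reflect: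
  assumes "0 \<le> t"
  shows "N u t = integral {0..2*pi} (\<lambda>\<phi>. max 0 (u - U t \<phi>)) - 2 * pi * u"
proof -
  have i: "((\<lambda>\<phi>. max 0 (u - U t \<phi>)) has_integral integral {0..2*pi} (\<lambda>\<phi>. max 0 (u - U t \<phi>))) {0..2*pi}"
    using assms by (intro integrable_integral integrable_continuous_interval continuous_intros) auto
  have "(U t has_integral 0) {0..2*pi}"
    using integrable_integral[OF U_integrable(1)[OF assms]] mean_U[OF assms] by simp
  from has_integral_diff[OF has_integral_add[OF i this] has_integral_const_real[of u 0 "2*pi"]]
  have "((\<lambda>\<phi>. max 0 (u - U t \<phi>) + U t \<phi> - u) has_integral
      integral {0..2*pi} (\<lambda>\<phi>. max 0 (u - U t \<phi>)) - 2 * pi * u) {0..2*pi}" by simp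
  moreover have "max 0 (u - U t \<phi>) + U t \<phi> - u = max 0 (U t \<phi> - u)" for \<phi> by auto
  ultimately show ?thesis unfolding N_def by (simp add: integral_unique)
qed

lemma continuous_on_N: "continuous_on (UNIV \<times> {0..}) (\<lambda>(u, t). N u t)"
proof -
  have "continuous_on (UNIV \<times> {0..}) (\<lambda>x. integral (cbox 0 (2*pi)) (\<lambda>\<phi>. max 0 (U (snd x) \<phi> - fst x)))"
    by (intro integral_continuous_on_param) (auto simp: split_beta intro!: continuous_intros)
  then show ?thesis unfolding N_def split_beta by simp
qed

text \<open>\<open>max 0 (- 2 * pi * u)\<close> is the value of \<open>N\<close> for U = 0, hence
  its limit as t tends to infinity.\<close>

lemma N_le:
  assumes "0 \<le> t" "\<And>\<phi>. \<bar>U t \<phi>\<bar> \<le> e"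
  shows "N u t \<le> max 0 (- 2 * pi * u) + 2 * pi * e"
proof -
  have e: "0 \<le> e" using assms(2)[of 0] by linarith
  have le: "integral {0..2*pi} (\<lambda>\<phi>. max 0 (f \<phi>)) \<le> 2 * pi * e"
    if "continuous_on {0..2*pi} f" "\<And>\<phi>. f \<phi> \<le> e" for f
  proof -
    have "integral {0..2*pi} (\<lambda>\<phi>. max 0 (f \<phi>)) \<le> integral {0..2*pi} (\<lambda>\<phi>. e)"
      using that e by (intro integral_le integrable_continuous_interval continuous_intros) auto
    then show ?thesis by simp
  qed
  show ?thesis
  proof (cases "0 \<le> u")
    case True
    have "U t \<phi> - u \<le> e" for \<phi> using assms(2)[of \<phi>] True by linarith
    then have "N u t \<le> 2 * pi * e" unfolding N_def using assms(1) by (intro le continuous_intros) auto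
    then show ?thesis by linarith
  next
    case False
    have "u - U t \<phi> \<le> e" for \<phi> using assms(2)[of \<phi>] False by linarith
    then have "integral {0..2*pi} (\<lambda>\<phi>. max 0 (u - U t \<phi>)) \<le> 2 * pi * e"
      using assms(1) by (intro le continuous_intros) auto
    then show ?thesis unfolding N_reflect[OF assms(1)] by simp
  qed
qed

lemma N_outside:
  assumes "0 \<le> t" "\<And>\<phi>. \<bar>U t \<phi>\<bar> \<le> K" "K \<le> \<bar>u\<bar>"
  shows "N u t = max 0 (- 2 * pi * u)"
proof (cases "0 \<le> u")
  case True
  have "max 0 (U t \<phi> - u) = 0" for \<phi> using assms(2)[of \<phi>] assms(3) True by auto
  then show ?thesis unfolding N_def using True by simp
next
  case False
  have "max 0 (u - U t \<phi>) = 0" for \<phi> using assms(2)[of \<phi>] assms(3) False by auto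
  then show ?thesis unfolding N_reflect[OF assms(1)] using False by (simp add: mult_nonneg_nonpos)
qed


text \<open>If the inequality failed, the difference would have a positive global maximum, because
  the comparison function dominates \<open>max 0 (- 2 * pi * u)\<close>, the value of
  \<open>N\<close> at large levels and its limit at large times. A maximum is impossible beyond the
  edges of the strip (linear against o(h) growth), at t = 0 (growth hypothesis) and at interior
  points (Monge-Ampere).\<close>

lemma comparison:
  assumes c: "0 < c" "c < 1" and P: "0 < P"
    and growth: "\<And>u t. 0 < t \<Longrightarrow> N u 0 \<le> N u t + 2 * pi * P * t"
  defines "q \<equiv> 2 * P / c\<^sup>2"
  shows "\<exists>e>0. \<forall>u t. 0 \<le> t \<longrightarrow> N u t \<le> q * strip_mean (u / q) (c * t + e)"
proof -
  have q: "0 < q" using c P by (simp add: q_def)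
  obtain K where K: "0 < K" "\<And>t \<phi>. 0 \<le> t \<Longrightarrow> \<bar>U t \<phi>\<bar> \<le> K" using U_bounded by blast
  obtain e where e: "0 < e" "\<And>v. \<bar>v\<bar> \<le> K / q \<Longrightarrow> \<bar>cosh e * tanh v\<bar> < 1 \<and> c * pi / 2 < arctan (sin (strip_angle v e) / sinh e)"
    using exists_strip_shift[OF c, of "K / q"] K(1) q by auto
  define M where "M = (\<lambda>u t. q * strip_mean (u / q) (c * t + e))"
  have s_pos: "0 < c * t + e" if "0 \<le> t" for t using that c e(1) by (simp add: add_nonneg_pos)
  have M_ge: "0 \<le> M u t" "- 2 * pi * u \<le> M u t" if "0 \<le> t" for u t
  proof -
    show "0 \<le> M u t" unfolding M_def using q strip_mean_nonneg by simp
    have "- 2 * pi * (u / q) \<le> strip_mean (u / q) (c * t + e)"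
      using strip_mean_minus[OF s_pos[OF that], of "u / q"] strip_mean_nonneg[of "- (u / q)" "c * t + e"] by simp
    then have "q * (- 2 * pi * (u / q)) \<le> M u t" unfolding M_def using q by (intro mult_left_mono) auto
    then show "- 2 * pi * u \<le> M u t" using q by simp
  qed
  have "N u1 t1 \<le> M u1 t1" if t1: "0 \<le> t1" for u1 t1
  proof (rule ccontr)
    define \<Phi> where "\<Phi> = (\<lambda>u t. N u t - M u t)"
    assume "\<not> N u1 t1 \<le> M u1 t1"
    then have pos1: "0 < \<Phi> u1 t1" by (simp add: \<Phi>_def)
    \<comment> \<open>With this accuracy, \<open>N\<close> exceeds
      \<open>max 0 (- 2 * pi * u)\<close> by at most half the assumed positive value from time
      \<open>T0\<close> on.\<close>
    obtain T0 where T0: "0 \<le> T0" "\<And>t \<phi>. T0 \<le> t \<Longrightarrow> \<bar>U t \<phi>\<bar> \<le> \<Phi> u1 t1 / (4 * pi)"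
      using U_small[of "\<Phi> u1 t1 / (4 * pi)"] pos1 by (auto simp: zero_less_divide_iff)
    define T where "T = max T0 t1"
    define K' where "K' = max K \<bar>u1\<bar>"
    define S where "S = {- K'..K'} \<times> {0..T}"
    have "compact S" unfolding S_def by (intro compact_Times) auto
    moreover have "(u1, t1) \<in> S" using t1 by (auto simp: S_def K'_def T_def)
    moreover have "continuous_on S (\<lambda>x. \<Phi> (fst x) (snd x))"
    proof -
      have 1: "continuous_on S (\<lambda>x. N (fst x) (snd x))"
        using continuous_on_subset[OF continuous_on_N, of S] by (force simp: S_def split_beta)
      have "continuous_on S (\<lambda>x. (\<lambda>(u, t). strip_mean u t) (fst x / q, c * snd x + e))"
        by (rule continuous_on_compose2[OF continuous_on_strip_mean])
           (use q s_pos in \<open>auto simp: S_def intro!: continuous_intros\<close>)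
      then show ?thesis unfolding \<Phi>_def M_def using 1 by (auto intro!: continuous_intros)
    qed
    ultimately obtain x0 where x0: "x0 \<in> S" "\<And>x. x \<in> S \<Longrightarrow> \<Phi> (fst x) (snd x) \<le> \<Phi> (fst x0) (snd x0)"
      using continuous_attains_sup[of S "\<lambda>x. \<Phi> (fst x) (snd x)"] by blast
    define u t where "u = fst x0" and "t = snd x0"
    have t0: "0 \<le> t" using x0(1) by (auto simp: S_def t_def)
    have pos: "0 < \<Phi> u t" using x0(2)[OF \<open>(u1, t1) \<in> S\<close>] pos1 by (simp add: u_def t_def)
    have global: "N u' t' - M u' t' \<le> N u t - M u t" if t': "0 \<le> t'" for u' t'
    proof -
      have "\<Phi> u' t' \<le> \<Phi> u t"
      proof (cases "(u', t') \<in> S")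
        case True
        then show ?thesis using x0(2)[OF True] by (simp add: u_def t_def)
      next
        case False
        then consider "K \<le> \<bar>u'\<bar>" | "T0 \<le> t'" using t' by (auto simp: S_def K'_def T_def)
        then show ?thesis
        proof cases
          case 1
          have "N u' t' = max 0 (- 2 * pi * u')" using N_outside[OF that K(2)[OF that] 1] .
          then show ?thesis using M_ge[OF that, of u'] pos unfolding \<Phi>_def by linarith
        next
          case 2
          have "N u' t' \<le> max 0 (- 2 * pi * u') + 2 * pi * (\<Phi> u1 t1 / (4 * pi))"
            using N_le[OF that T0(2)[OF 2]] .
          moreover have "2 * pi * (\<Phi> u1 t1 / (4 * pi)) = \<Phi> u1 t1 / 2" by simp
          moreover have "\<Phi> u1 t1 \<le> \<Phi> u t" using x0(2)[OF \<open>(u1, t1) \<in> S\<close>] by (simp add: u_def t_def)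
          moreover have "\<Phi> u' t' = N u' t' - M u' t'" by (simp add: \<Phi>_def)
          ultimately show ?thesis using M_ge[OF that, of u'] pos1 by linarith
        qed
      qed
      then show ?thesis by (simp add: \<Phi>_def)
    qed
    have uK: "\<bar>u\<bar> < K"
    proof (rule ccontr)
      assume "\<not> \<bar>u\<bar> < K"
      then have "N u t = max 0 (- 2 * pi * u)" using N_outside[OF t0 K(2)[OF t0]] by simp
      then show False using M_ge[OF t0, of u] pos unfolding \<Phi>_def by linarith
    qed
    define v s where "v = u / q" and "s = c * t + e"
    have s: "0 < s" unfolding s_def by (rule s_pos[OF t0])
    define B where "B = K + \<bar>u\<bar>"
    have B: "0 < B" using K(1) by (simp add: B_def)
    have UB: "U t \<phi> - u \<le> B" "u - U t \<phi> \<le> B" for \<phi> using K(2)[OF t0, of \<phi>] by (auto simp: B_def)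
    \<comment> \<open>Level above the strip, level below it, initial circle, interior.\<close>
    consider "1 \<le> cosh s * tanh v" | "1 \<le> cosh s * tanh (- v)" | "\<bar>cosh s * tanh v\<bar> < 1" "t = 0"
      | "\<bar>cosh s * tanh v\<bar> < 1" "0 < t" using t0 by fastforce
    then show False
    proof cases
      case 1
      have M0: "M u t = 0" unfolding M_def using strip_mean_eq_0[OF s 1] by (simp add: v_def s_def)
      show False
      proof (rule edge_contradiction[OF s 1 q B, of "N u t"])
        show "0 < N u t" using pos M0 by (simp add: \<Phi>_def)
        fix h :: real assume h: "0 < h"
        have "(1 + h / B) * N u t \<le> N (u - h) t"
          using pos_part_integral_growth[of 0 "2*pi" "\<lambda>\<phi>. U t \<phi> - u" B h] UB B h t0
          unfolding N_def by (simp add: continuous_intros algebra_simps)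
        moreover have "M (u - h) t = q * strip_mean (v - h / q) s"
          by (simp add: M_def v_def s_def diff_divide_distrib)
        ultimately show "(1 + h / B) * N u t - q * strip_mean (v - h / q) s \<le> N u t"
          using global[OF t0, of "u - h"] M0 by linarith
      qed
    next
      case 2
      \<comment> \<open>Below the strip, both functions are stripped of the common affine part -2 pi
        u; what remains behaves as at the upper edge.\<close>
      define N' where "N' = (\<lambda>u. integral {0..2*pi} (\<lambda>\<phi>. max 0 (u - U t \<phi>)))"
      have M_eq: "M u' t = q * strip_mean (- (u' / q)) s - 2 * pi * u'" for u'
        using strip_mean_minus[OF s, of "u' / q"] q unfolding M_def s_def by (simp add: distrib_left)
      have M0: "M u t = - 2 * pi * u" using M_eq[of u] strip_mean_eq_0[OF s 2] by (simp add: v_def)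
      have N_eq: "N u' t = N' u' - 2 * pi * u'" for u' unfolding N'_def by (rule N_reflect[OF t0])
      show False
      proof (rule edge_contradiction[OF s 2 q B, of "N' u"])
        show "0 < N' u" using pos M0 N_eq[of u] by (simp add: \<Phi>_def)
        fix h :: real assume h: "0 < h"
        have "(1 + h / B) * N' u \<le> N' (u + h)"
          using pos_part_integral_growth[of 0 "2*pi" "\<lambda>\<phi>. u - U t \<phi>" B h] UB B h t0
          unfolding N'_def by (simp add: continuous_intros algebra_simps)
        moreover have "- ((u + h) / q) = - v - h / q" by (simp add: v_def add_divide_distrib)
        then have "M (u + h) t = q * strip_mean (- v - h / q) s - 2 * pi * (u + h)"
          using M_eq[of "u + h"] by (simp only:)
        ultimately show "(1 + h / B) * N' u - q * strip_mean (- v - h / q) s \<le> N' u"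
          using global[OF t0, of "u + h"] M0 N_eq[of u] N_eq[of "u + h"] by linarith
      qed
    next
      case 3
      have s_eq: "s = e" using 3 by (simp add: s_def)
      have "\<bar>v\<bar> \<le> K / q" using uK q by (simp add: v_def divide_right_mono)
      then have ang: "c * pi / 2 < arctan (sin (strip_angle v e) / sinh e)" using e(2) by blast
      \<comment> \<open>Maximality and \<open>growth\<close> force a slope of at least -2 pi P at t
        = 0, but the slope is -2 q c times an arctangent exceeding c pi / 2, hence less than -q c^2
        pi = -2 pi P.\<close>
      have "((\<lambda>h. strip_mean (v + 0 * h) (e + c * h)) has_real_derivative
          - 2 * 0 * strip_angle v e - 2 * c * arctan (sin (strip_angle v e) / sinh e)) (at 0)"
        by (rule strip_mean_line_deriv[OF e(1)])
      from DERIV_cmult[OF this, of q]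
      have "(M u has_real_derivative q * (- 2 * c * arctan (sin (strip_angle v e) / sinh e))) (at 0)"
        by (simp add: M_def[abs_def] v_def add.commute)
      then have "((\<lambda>h. (M u h - M u 0) / h) \<longlongrightarrow> q * (- 2 * c * arctan (sin (strip_angle v e) / sinh e))) (at_right 0)"
        unfolding has_field_derivative_iff by (auto intro: filterlim_mono at_le)
      moreover have "- (2 * pi * P) \<le> (M u h - M u 0) / h" if "0 < h" for h
      proof -
        have "- (2 * pi * P) * h \<le> M u h - M u 0"
          using global[of h u] growth[OF that, of u] that 3 by (simp add: algebra_simps)
        then show ?thesis using that by (simp add: pos_le_divide_eq)
      qed
      ultimately have "- (2 * pi * P) \<le> q * (- 2 * c * arctan (sin (strip_angle v e) / sinh e))"
        by (elim tendsto_lowerbound) (auto simp: eventually_at_filter)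
      moreover have "q * (2 * c) * (c * pi / 2) < q * (2 * c) * arctan (sin (strip_angle v e) / sinh e)"
        using ang q c by (intro mult_strict_left_mono) auto
      moreover have "q * (2 * c) * (c * pi / 2) = 2 * pi * P"
        using c by (simp add: q_def power2_eq_square)
      ultimately show False by (simp add: mult_ac)
    next
      case 4
      \<comment> \<open>A level that is not crossed would give \<open>N\<close> the value 0 or -2 pi
        u, both dominated by \<open>M\<close>.\<close>
      have "\<exists>\<phi>\<in>{0..2*pi}. u < U t \<phi>"
      proof (rule ccontr)
        assume "\<not> ?thesis"
        then have "N u t = integral {0..2*pi} (\<lambda>\<phi>. 0)"
          unfolding N_def by (intro integral_cong) (auto simp: not_less)
        then show False using M_ge[OF t0, of u] pos unfolding \<Phi>_def by simp
      qed
      then obtain \<phi>1 where hi: "\<phi>1 \<in> {0..2*pi}" "u < U t \<phi>1" by blast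
      have "\<exists>\<phi>\<in>{0..2*pi}. U t \<phi> < u"
      proof (rule ccontr)
        assume "\<not> ?thesis"
        then have "integral {0..2*pi} (\<lambda>\<phi>. max 0 (u - U t \<phi>)) = integral {0..2*pi} (\<lambda>\<phi>. 0)"
          by (intro integral_cong) (auto simp: not_less)
        then show False using M_ge[OF t0, of u] pos N_reflect[OF t0, of u] unfolding \<Phi>_def by simp
      qed
      then obtain \<phi>2 where lo: "\<phi>2 \<in> {0..2*pi}" "U t \<phi>2 < u" by blast
      define D where "D = strip_density v s"
      have D: "0 < D" unfolding D_def by (rule strip_density_pos[OF 4(1)])
      define x where "x = - (tanh s * sinh v * cosh v)"
      have lim1: "((\<lambda>d. (M (u + d) t + M (u - d) t - 2 * M u t) / d\<^sup>2) \<longlongrightarrow> q * ((1 / q)\<^sup>2 * D)) (at_right 0)"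
        using tendsto_mult_left[OF strip_mean_second_difference_horizontal[OF s 4(1), of "1 / q"], of q]
        unfolding M_def D_def v_def s_def by (simp add: add_divide_distrib diff_divide_distrib algebra_simps)
      \<comment> \<open>Time runs at speed \<open>c\<close> and levels are scaled by
        \<open>q\<close> inside \<open>M\<close>, so the stationary slope \<open>x\<close> of the
        strip becomes q c x.\<close>
      have lim2: "((\<lambda>h. (M (u + q * c * x * h) (t + h) + M (u - q * c * x * h) (t - h) - 2 * M u t) / h\<^sup>2)
          \<longlongrightarrow> q * (c\<^sup>2 * 4 / D)) (at_right 0)"
        using tendsto_mult_left[OF strip_mean_second_difference_oblique[OF s 4(1), of c], of q] q
        unfolding M_def D_def v_def s_def x_def by (simp add: add_divide_distrib diff_divide_distrib algebra_simps)
      \<comment> \<open>The density \<open>D\<close> and the scale \<open>q\<close> cancel, leaving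
        the determinant 4 c^2 < 4.\<close>
      have "4 \<le> q * ((1 / q)\<^sup>2 * D) * (q * (c\<^sup>2 * 4 / D))"
        using D q by (intro interior_max[OF 4(2) global hi lo _ lim1 lim2]) auto
      also have "\<dots> = 4 * c\<^sup>2" using D q by (simp add: power2_eq_square)
      finally have "1 \<le> c\<^sup>2" by simp
      moreover have "c\<^sup>2 < 1" using c by (simp add: power_less_one_iff)
      ultimately show False by simp
    qed
  qed
  then show ?thesis unfolding M_def using e(1) by blast
qed

text \<open>The level \<open>u\<close> is the top of the strip at time c t, hence above the strip at
  the later time c t + e. There the comparison function vanishes, so N = 0, and continuity gives the
  bound at every angle. No limit in \<open>e\<close> is needed.\<close>

lemma U_le:
  assumes c: "0 < c" "c < 1" and P: "0 < P"
    and growth: "\<And>u t. 0 < t \<Longrightarrow> N u 0 \<le> N u t + 2 * pi * P * t"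
    and t: "0 < t" and \<phi>: "\<phi> \<in> {0..2*pi}"
  shows "U t \<phi> \<le> 2 * P / c\<^sup>2 * artanh (1 / cosh (c * t))"
proof -
  define q where "q = 2 * P / c\<^sup>2"
  have q: "0 < q" using c P by (simp add: q_def)
  obtain e where e: "0 < e" "\<And>u t. 0 \<le> t \<Longrightarrow> N u t \<le> q * strip_mean (u / q) (c * t + e)"
    using comparison[OF c P growth] unfolding q_def by blast
  define u where "u = q * artanh (1 / cosh (c * t))"
  have ct: "0 < c * t" using c t by simp
  have "tanh (u / q) = 1 / cosh (c * t)"
    using strip_log_arg_bound[OF ct, of 0] q by (simp add: u_def tanh_artanh_real)
  moreover have "cosh (c * t) \<le> cosh (c * t + e)" using ct e(1) cosh_real_strict_mono[of "c * t" "c * t + e"] by auto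
  ultimately have "1 \<le> cosh (c * t + e) * tanh (u / q)" by simp
  then have "N u t \<le> 0" using e(2)[of t u] strip_mean_eq_0[of "c * t + e" "u / q"] ct e(1) t by simp
  have "integral {0..2*pi} (\<lambda>\<phi>. max 0 (U t \<phi> - u)) = 0"
    using \<open>N u t \<le> 0\<close> U_integrable(2)[of t u] t unfolding N_def
    by (intro antisym integral_nonneg) auto
  then have "((\<lambda>\<phi>. max 0 (U t \<phi> - u)) has_integral 0) (cbox 0 (2*pi))"
    using integrable_integral[OF U_integrable(2)[of t u]] t by simp
  then have "max 0 (U t \<phi> - u) = 0"
    using \<phi> t pi_gt_zero by (intro has_integral_0_cbox_imp_0[of 0 "2*pi" "\<lambda>\<phi>. max 0 (U t \<phi> - u)"])
      (auto intro!: continuous_intros simp del: pi_gt_zero)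
  then show ?thesis by (simp add: u_def q_def max_def split: if_splits)
qed
end
text \<open>The outer radius and the slow-down factor are taken to be the same \<open>c\<close>, so
  one limit c -> 1 removes both.\<close>

lemma Re_le_of_circle_growth:
  fixes L :: "complex \<Rightarrow> complex"
  assumes L: "L holomorphic_on ball 0 1" "L 0 = 0" and P: "0 < P"
    and growth: "\<And>u \<rho> \<rho>'. 0 < \<rho>' \<Longrightarrow> \<rho>' < \<rho> \<Longrightarrow> \<rho> < 1 \<Longrightarrow>
      integral {0..2*pi} (\<lambda>\<phi>. max 0 (Re (L (of_real \<rho> * cis \<phi>)) - u)) \<le>
      integral {0..2*pi} (\<lambda>\<phi>. max 0 (Re (L (of_real \<rho>' * cis \<phi>)) - u)) + 2 * pi * P * ln (\<rho> / \<rho>')"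
    and z: "z \<in> ball 0 1"
  shows "Re (L z) \<le> 2 * P * ln ((1 + cmod z) / (1 - cmod z))"
proof (cases "z = 0")
  case False
  define \<rho> where "\<rho> = cmod z"
  have \<rho>: "0 < \<rho>" "\<rho> < 1" using False z by (auto simp: \<rho>_def)
  have le: "Re (L z) \<le> 2 * P / c\<^sup>2 * artanh (1 / cosh (c * ln (c / \<rho>)))" if c: "\<rho> < c" "c < 1" for c
  proof -
    have c0: "0 < c" using \<rho> c by linarith
    interpret disc_log L c by unfold_locales (use L c0 c in auto)
    define t where "t = ln (c / \<rho>)"
    have t: "0 < t" using c \<rho> by (simp add: t_def)
    have "c * exp (- t) = \<rho>" using c0 \<rho> by (simp add: t_def exp_minus)
    then have "U t (Arg2pi z) = Re (L z)"
      unfolding U_polar using Arg2pi_eq[of z] by (simp add: \<rho>_def cis_conv_exp)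
    moreover have "U t (Arg2pi z) \<le> 2 * P / c\<^sup>2 * artanh (1 / cosh (c * t))"
    proof (rule U_le[OF c0 c(2) P _ t])
      show "Arg2pi z \<in> {0..2*pi}" using Arg2pi[of z] by auto
      fix u s :: real assume s: "0 < s"
      have "c / (c * exp (- s)) = exp s" using c0 by (simp add: exp_minus field_simps)
      then have "ln (c / (c * exp (- s))) = s" by simp
      then show "N u 0 \<le> N u s + 2 * pi * P * s"
        using growth[of "c * exp (- s)" c u] c0 c s by (simp add: N_def U_polar)
    qed
    ultimately show ?thesis by (simp add: t_def)
  qed
  have cosh: "cosh (ln (1 / \<rho>)) = (1 + \<rho>\<^sup>2) / (2 * \<rho>)"
    using \<rho> by (simp add: cosh_ln_real field_simps power2_eq_square)
  have "2 * \<rho> < 1 + \<rho>\<^sup>2"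
  proof -
    have "0 < (1 - \<rho>)\<^sup>2" using \<rho> by simp
    then show ?thesis by (simp add: power2_diff)
  qed
  then have b: "1 / cosh (1 * ln (1 / \<rho>)) \<in> {-1<..<1}"
    using \<rho> unfolding mult_1 cosh by (auto intro: less_trans[of _ 0])
  have ev: "eventually (\<lambda>c. c \<in> {\<rho><..<1}) (at_left 1)"
    using \<rho> by (intro eventually_at_left_real) auto
  have "((\<lambda>c. 2 * P / c\<^sup>2 * artanh (1 / cosh (c * ln (c / \<rho>)))) \<longlongrightarrow> 2 * P / 1\<^sup>2 * artanh (1 / cosh (1 * ln (1 / \<rho>)))) (at_left 1)"
    by (intro tendsto_intros) (use \<rho> b in auto)
  then have "Re (L z) \<le> 2 * P / 1\<^sup>2 * artanh (1 / cosh (1 * ln (1 / \<rho>)))"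
    by (rule tendsto_lowerbound) (use ev le in \<open>auto elim!: eventually_mono\<close>)
  \<comment> \<open>Here 1 / cosh (ln (1 / \<rho>)) = 2 \<rho> / (1 + \<rho>^2), for which (1 + y) /
    (1 - y) is a perfect square; this absorbs the factor 1/2 in artanh.\<close>
  also have "artanh (1 / cosh (1 * ln (1 / \<rho>))) = ln ((1 + \<rho>) / (1 - \<rho>))"
  proof -
    have "(1 + 2 * \<rho> / (1 + \<rho>\<^sup>2)) / (1 - 2 * \<rho> / (1 + \<rho>\<^sup>2)) = (1 + \<rho>\<^sup>2 + 2 * \<rho>) / (1 + \<rho>\<^sup>2 - 2 * \<rho>)"
    proof -
      have "(1 + x / D) / (1 - x / D) = (D + x) / (D - x)" if "0 < D" for x D :: real
      proof -
        have "1 + x / D = (D + x) / D" "1 - x / D = (D - x) / D"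
          using that by (auto simp: add_divide_distrib diff_divide_distrib)
        then show ?thesis using that by simp
      qed
      then show ?thesis using \<rho> by (simp add: add_pos_nonneg)
    qed
    also have "\<dots> = ((1 + \<rho>) / (1 - \<rho>))\<^sup>2" by (simp add: power_divide power2_sum power2_diff)
    finally show ?thesis using \<rho> unfolding mult_1 cosh artanh_def by (simp add: ln_realpow)
  qed
  finally show ?thesis by (simp add: \<rho>_def)
qed (simp add: L)

lemma valent_upper_bound:
  assumes g: "g holomorphic_on ball 0 1" "\<And>z. z \<in> ball 0 1 \<Longrightarrow> g z \<noteq> 0" "g 0 = 1"
    and v: "factors_valent p g" and x: "x \<in> ball 0 1"
  shows "cmod (g x) \<le> ((1 + cmod x) / (1 - cmod x)) ^ (2 * p)"
proof -
  have "contractible (ball (0::complex) 1)" by (simp add: convex_imp_contractible)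
  from contractible_imp_holomorphic_log[OF g(1) this g(2)]
  obtain L0 where L0: "L0 holomorphic_on ball 0 1" "\<And>z. z \<in> ball 0 1 \<Longrightarrow> g z = exp (L0 z)" by blast
  define L where "L = (\<lambda>z. L0 z - L0 0)"
  have L: "L holomorphic_on ball 0 1" "L 0 = 0" "\<And>z. z \<in> ball 0 1 \<Longrightarrow> g z = exp (L z)"
    using L0 g(3) by (auto simp: L_def exp_diff intro!: holomorphic_intros)
  have Re_L: "ln (cmod (g z)) = Re (L z)" if "z \<in> ball 0 1" for z using L(3)[OF that] by simp
  \<comment> \<open>Since g - 1 vanishes at 0, \<open>p = 0\<close> is impossible; the comparison
    needs a positive growth rate.\<close>
  have "p \<noteq> 0"
  proof
    assume "p = 0"
    obtain Z m Q where Z: "finite Z" "sum m Z \<le> p" "\<forall>z\<in>ball 0 1. Q z \<noteq> 0 \<and> g z - 1 = (\<Prod>w\<in>Z. (z - w) ^ m w) * Q z"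
      using v[unfolded factors_valent_def, THEN spec, of 1] by blast
    then have "(\<Prod>w\<in>Z. (0 - w) ^ m w) = 0" using g(3) Z(3)[THEN bspec, of 0] by simp
    moreover have "\<forall>w\<in>Z. m w = 0" using Z(1,2) \<open>p = 0\<close> by simp
    ultimately show False by simp
  qed
  then have P: "0 < real p" by simp
  have "Re (L x) \<le> 2 * real p * ln ((1 + cmod x) / (1 - cmod x))"
  proof (rule Re_le_of_circle_growth[OF L(1,2) P _ x])
    fix u \<rho> \<rho>' :: real assume \<rho>: "0 < \<rho>'" "\<rho>' < \<rho>" "\<rho> < 1"
    have cont: "continuous_on (ball 0 1) (\<lambda>z. Re (L z))"
      using L(1) by (intro continuous_intros holomorphic_on_imp_continuous_on)
    have eq: "integral\<^sup>L circle_measure (\<lambda>\<phi>. max u (ln (cmod (g (of_real r * cis \<phi>))))) =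
        integral {0..2*pi} (\<lambda>\<phi>. max 0 (Re (L (of_real r * cis \<phi>)) - u)) + 2 * pi * u" if r: "0 < r" "r < 1" for r
    proof -
      have e: "max u (ln (cmod (g (of_real r * cis \<phi>)))) = max 0 (Re (L (of_real r * cis \<phi>)) - u) + u" for \<phi>
        using Re_L[of "of_real r * cis \<phi>"] r by (simp add: norm_mult)
      have c: "continuous_on {0..2*pi} (\<lambda>\<phi>. max 0 (Re (L (of_real r * cis \<phi>)) - u))"
        by (intro continuous_intros continuous_on_circle[OF cont r])
      have "continuous_on {0..2*pi} (\<lambda>\<phi>. max 0 (Re (L (of_real r * cis \<phi>)) - u) + u)"
        by (intro continuous_intros continuous_on_circle[OF cont r])
      from circle_integral_continuous(2)[OF this] show ?thesis
        using integral_add[OF integrable_continuous_interval[OF c] integrable_const_ivl[of u 0 "2*pi"]]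
        unfolding e by simp
    qed
    show "integral {0..2*pi} (\<lambda>\<phi>. max 0 (Re (L (of_real \<rho> * cis \<phi>)) - u)) \<le>
      integral {0..2*pi} (\<lambda>\<phi>. max 0 (Re (L (of_real \<rho>' * cis \<phi>)) - u)) + 2 * pi * real p * ln (\<rho> / \<rho>')"
      using valent_circle_mean[OF g(1,2) v \<rho>, of u] eq[of \<rho>] eq[of \<rho>'] \<rho> by simp
  qed
  moreover have R: "0 < (1 + cmod x) / (1 - cmod x)" using x by (auto intro!: divide_pos_pos add_pos_nonneg)
  moreover have "2 * real p * ln ((1 + cmod x) / (1 - cmod x)) = ln (((1 + cmod x) / (1 - cmod x)) ^ (2 * p))"
    using R by (subst ln_realpow) auto
  ultimately have "Re (L x) \<le> ln (((1 + cmod x) / (1 - cmod x)) ^ (2 * p))" by linarith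
  then have "exp (Re (L x)) \<le> exp (ln (((1 + cmod x) / (1 - cmod x)) ^ (2 * p)))"
    by (simp only: exp_le_cancel_iff)
  also have "\<dots> = ((1 + cmod x) / (1 - cmod x)) ^ (2 * p)" by (rule exp_ln[OF zero_less_power[OF R]])
  finally show ?thesis using L(3)[OF x] by simp
qed

text \<open>For c \<noteq> 0, 1 / g - c is the zero-free function -c / g times g - 1 / c, and 1 / g
  has no zeros.\<close>

lemma factors_valent_inverse:
  assumes g: "g holomorphic_on ball 0 1" "\<And>z. z \<in> ball 0 1 \<Longrightarrow> g z \<noteq> 0" and v: "factors_valent p g"
  shows "factors_valent p (\<lambda>z. 1 / g z)"
  unfolding factors_valent_def
proof
  fix c :: complex
  show "\<exists>Z m Q. finite Z \<and> sum m Z \<le> p \<and> Q holomorphic_on ball 0 1 \<and>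
     (\<forall>z\<in>ball 0 1. Q z \<noteq> 0 \<and> 1 / g z - c = (\<Prod>w\<in>Z. (z - w) ^ m w) * Q z)"
  proof (cases "c = 0")
    case True
    then show ?thesis using g
      by (intro exI[of _ "{}"] exI[of _ "\<lambda>_. 0"] exI[of _ "\<lambda>z. 1 / g z"]) (auto intro!: holomorphic_intros)
  next
    case False
    obtain Z m Q where Z: "finite Z" "sum m Z \<le> p" "Q holomorphic_on ball 0 1"
      "\<And>z. z \<in> ball 0 1 \<Longrightarrow> Q z \<noteq> 0" "\<And>z. z \<in> ball 0 1 \<Longrightarrow> g z - 1 / c = (\<Prod>w\<in>Z. (z - w) ^ m w) * Q z"
      using v[unfolded factors_valent_def, THEN spec, of "1 / c"] by blast
    have "1 / g z - c = (\<Prod>w\<in>Z. (z - w) ^ m w) * (- c / g z * Q z)" if "z \<in> ball 0 1" for z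
    proof -
      have "1 / g z - c = - c / g z * (g z - 1 / c)" using g(2)[OF that] False by (simp add: field_simps)
      then show ?thesis unfolding Z(5)[OF that] by (simp add: mult_ac)
    qed
    then show ?thesis using Z g False
      by (intro exI[of _ Z] exI[of _ m] exI[of _ "\<lambda>z. - c / g z * Q z"]) (auto intro!: holomorphic_intros)
  qed
qed

section \<open>Zeros and multiplicities\<close>

text \<open>On a connected open set, a holomorphic function that is not identically zero has a
  nonzero derivative of some order at \<open>z\<close>, so the least such order is genuine.\<close>

lemma zero_mult_eq_zorder:
  assumes F: "F holomorphic_on S" "open S" "connected S" "z \<in> S" "\<exists>w\<in>S. F w \<noteq> 0"
  shows "int (zero_mult F z) = zorder F z"
proof -
  have "\<exists>n. (deriv ^^ n) F z \<noteq> 0"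
  proof (rule ccontr)
    assume "\<not> ?thesis"
    then have "F w = 0" if "w \<in> S" for w
      using holomorphic_fun_eq_0_on_connected[OF F(1-3), of z w] F(4) that by simp
    then show False using F(5) by blast
  qed
  then have nz: "(deriv ^^ zero_mult F z) F z \<noteq> 0" unfolding zero_mult_def by (rule LeastI_ex)
  have "zorder F z = int (zero_mult F z)"
    using F nz not_less_Least[of _ "\<lambda>n. (deriv ^^ n) F z \<noteq> 0"]
    by (intro zorder_zero_eqI[of F S]) (auto simp: zero_mult_def)
  then show ?thesis by simp
qed

lemma eventually_neq_zero:
  assumes F: "F holomorphic_on S" "open S" "connected S" "z \<in> S" "\<exists>w\<in>S. F w \<noteq> (0::complex)"
  shows "eventually (\<lambda>w. F w \<noteq> 0) (at z)"
proof -
  obtain w where "w \<in> S" "F w \<noteq> 0" using F(5) by blast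
  from non_zero_neighbour_alt[OF F(1-4) this] show ?thesis by (rule eventually_mono) blast
qed

text \<open>Induction on the zero set, dividing out the full order of one zero at a time. Infinitude
  of \<open>S\<close> rules out the zero function.\<close>

lemma holomorphic_finite_zeros_factorization:
  assumes "finite Z" "q holomorphic_on S" "open S" "connected S" "infinite S" "Z = {z \<in> S. q z = 0}"
  shows "\<exists>m Q. Q holomorphic_on S \<and> (\<forall>z\<in>S. Q z \<noteq> 0 \<and> q z = (\<Prod>w\<in>Z. (z - w) ^ m w) * Q z)"
  using assms
proof (induction Z arbitrary: q rule: finite_induct)
  case empty
  then show ?case by (intro exI[of _ "\<lambda>_. 0"] exI[of _ q]) auto
next
  case (insert w Z)
  have wS: "w \<in> S" "q w = 0" using insert.prems(5) by auto
  have "\<exists>z\<in>S. q z \<noteq> 0"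
  proof (rule ccontr)
    assume "\<not> ?thesis"
    then have "{z \<in> S. q z = 0} = S" by auto
    then show False using insert.prems(4,5) insert.hyps(1) by (metis finite_insert)
  qed
  from zorder_exist_zero[OF insert.prems(1-3) wS(1) this]
  obtain d where d: "0 < d" "cball w d \<subseteq> S" "zor_poly q w holomorphic_on cball w d"
    "\<And>z. z \<in> cball w d \<Longrightarrow> q z = zor_poly q w z * (z - w) ^ nat (zorder q w) \<and> zor_poly q w z \<noteq> 0"
    by blast
  define n where "n = nat (zorder q w)"
  define q1 where "q1 = (\<lambda>z. if z = w then zor_poly q w w else q z / (z - w) ^ n)"
  have q1_near: "q1 z = zor_poly q w z" if "z \<in> ball w d" for z
    using d(4)[of z] that by (auto simp: q1_def n_def)
  have q_eq: "q z = (z - w) ^ n * q1 z" if "z \<in> S" for z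
    using d(4)[of w] d(1) wS(2) by (auto simp: q1_def n_def)
  have "q1 holomorphic_on (S - {w}) \<union> ball w d"
  proof (rule holomorphic_on_Un)
    have "(\<lambda>z. q z / (z - w) ^ n) holomorphic_on S - {w}"
      using insert.prems(1) by (intro holomorphic_intros) (auto intro: holomorphic_on_subset)
    then show "q1 holomorphic_on S - {w}" by (rule holomorphic_transform) (auto simp: q1_def)
    have "zor_poly q w holomorphic_on ball w d" using d(3) by (rule holomorphic_on_subset) auto
    then show "q1 holomorphic_on ball w d" by (rule holomorphic_transform) (simp add: q1_near)
  qed (use insert.prems(2) in auto)
  moreover have "(S - {w}) \<union> ball w d = S" using d(1,2) wS by auto
  ultimately have q1: "q1 holomorphic_on S" by simp
  have "q1 w \<noteq> 0" using d(4)[of w] d(1) by (simp add: q1_def)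
  then have "Z = {z \<in> S. q1 z = 0}"
    using insert.hyps(2) insert.prems(5) q_eq by (auto simp: q1_def split: if_splits)
  from insert.IH[OF q1 insert.prems(2-4) this]
  obtain m Q where Q: "Q holomorphic_on S" "\<forall>z\<in>S. Q z \<noteq> 0 \<and> q1 z = (\<Prod>w\<in>Z. (z - w) ^ m w) * Q z" by blast
  have "(\<Prod>v\<in>Z. (z - v) ^ (m(w := n)) v) = (\<Prod>v\<in>Z. (z - v) ^ m v)" for z
    using insert.hyps(2) by (intro prod.cong) auto
  then have "(\<Prod>v\<in>insert w Z. (z - v) ^ (m(w := n)) v) = (z - w) ^ n * (\<Prod>v\<in>Z. (z - v) ^ m v)" for z
    using insert.hyps by simp
  then show ?case using Q q_eq by (intro exI[of _ "m(w := n)"] exI[of _ Q]) (auto simp: mult.assoc)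
qed

lemma zorder_factorization:
  assumes "finite Z" "Q holomorphic_on S" "open S" "w \<in> S" "w \<in> Z" "Q w \<noteq> 0"
    and "\<And>z. z \<in> S \<Longrightarrow> q z = (\<Prod>w\<in>Z. (z - w) ^ m w) * Q z"
  shows "zorder q w = int (m w)"
proof (rule zorder_eqI[OF assms(3,4)])
  show "(\<lambda>z. (\<Prod>v\<in>Z - {w}. (z - v) ^ m v) * Q z) holomorphic_on S"
    by (intro holomorphic_intros assms)
  show "(\<Prod>v\<in>Z - {w}. (w - v) ^ m v) * Q w \<noteq> 0" using assms by auto
  show "q z = (\<Prod>v\<in>Z - {w}. (z - v) ^ m v) * Q z * (z - w) powi int (m w)" if "z \<in> S" for z
    using assms(7)[OF that] prod.remove[OF assms(1,5), of "\<lambda>v. (z - v) ^ m v"] by simp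
qed

lemma zorder_prod_list:
  "zorder (\<lambda>z. \<Prod>j<length xs. z - xs ! j) z = int (count (mset xs) z)"
proof (induction xs)
  case Nil
  then show ?case by (simp add: zorder_eq_0I)
next
  case (Cons x xs)
  have "(\<Prod>j<length (x # xs). w - (x # xs) ! j) = (w - x) * (\<Prod>j<length xs. w - xs ! j)" for w
    by (simp add: prod.lessThan_Suc_shift del: prod.lessThan_Suc)
  moreover have "zorder (\<lambda>w. (w - x) * (\<Prod>j<length xs. w - xs ! j)) z =
      zorder (\<lambda>w. w - x) z + zorder (\<lambda>w. \<Prod>j<length xs. w - xs ! j) z"
  proof (rule zorder_times_analytic)
    have "eventually (\<lambda>w. \<forall>a\<in>set (x # xs). w \<noteq> a) (at z)"
      by (intro eventually_ball_finite ballI eventually_neq_at_within) auto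
    then show "eventually (\<lambda>w. (w - x) * (\<Prod>j<length xs. w - xs ! j) \<noteq> 0) (at z)"
      by eventually_elim auto
  qed (auto intro!: analytic_intros)
  moreover have "zorder (\<lambda>w. w - x) z = (if x = z then 1 else 0)"
    by (auto intro!: zorder_eq_0I analytic_intros zorder_eqI[of UNIV _ "\<lambda>_. 1"])
  ultimately show ?case using Cons.IH by simp
qed

text \<open>The quotient with removable singularities removed is represented by any holomorphic
  \<open>g\<close> that agrees with f / P wherever P is nonzero.\<close>

theorem mainTheorem5:
  fixes f g :: "complex \<Rightarrow> complex" and s p :: nat and xs :: "complex list" and A :: complex
  assumes valent: "sp_valent s p f (ball 0 1)"
    and nzeros: "num_zeros f (ball 0 1) = enat s"
    and xs_len: "length xs = s"
    and xs_in: "set xs \<subseteq> ball 0 1"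
    and xs_mult: "\<forall>z\<in>ball 0 1. count (mset xs) z = zero_mult f z"
    and A_nz: "A \<noteq> 0"
    and g_hol: "g holomorphic_on ball 0 1"
    and g_eq: "\<forall>z\<in>ball 0 1. A * (\<Prod>j<s. z - xs ! j) \<noteq> 0 \<longrightarrow>
                 g z = f z / (A * (\<Prod>j<s. z - xs ! j))"
    and g0: "g 0 = 1"
  shows "\<forall>x\<in>ball 0 1.
           ((1 - cmod x) / (1 + cmod x)) ^ (2 * p) \<le> cmod (g x) \<and>
           cmod (g x) \<le> ((1 + cmod x) / (1 - cmod x)) ^ (2 * p)"
proof -
  define B where "B = (ball 0 1 :: complex set)"
  have B: "open B" "connected B" "infinite B"
    using uncountable_ball[of 1 "0::complex"] countable_finite by (auto simp: B_def)
  define R where "R = (\<lambda>z. \<Prod>j<s. z - xs ! j)"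
  have R_zero: "R z = 0 \<longleftrightarrow> z \<in> set xs" for z
    using xs_len by (auto simp: R_def in_set_conv_nth)
  have R_hol: "R holomorphic_on B" unfolding R_def by (intro holomorphic_intros)
  have zorder_R: "zorder R z = int (count (mset xs) z)" for z
    using zorder_prod_list[of xs z] xs_len by (simp add: R_def)
  have fhol: "f holomorphic_on B" using valent by (simp add: sp_valent_def B_def)
  \<comment> \<open>The product form holds off the finitely many points of \<open>xs\<close> and
    extends to them by continuity.\<close>
  have f_eq: "f z = A * R z * g z" if z: "z \<in> B" for z
  proof -
    define h where "h = (\<lambda>z. f z - A * R z * g z)"
    have "h holomorphic_on B"
      unfolding h_def using fhol R_hol g_hol by (intro holomorphic_intros) (auto simp: B_def)
    then have "isCont h z"
      using holomorphic_on_imp_continuous_on z B(1) continuous_on_eq_continuous_at by blast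
    moreover have "eventually (\<lambda>w. h w = 0) (at z)"
    proof -
      have "eventually (\<lambda>w. w \<in> B) (at z)" using z B by (intro eventually_at_in_open') auto
      moreover have "eventually (\<lambda>w. \<forall>a\<in>set xs. w \<noteq> a) (at z)"
        by (intro eventually_ball_finite ballI eventually_neq_at_within) auto
      ultimately show ?thesis
      proof eventually_elim
        case (elim w)
        then have "A * R w \<noteq> 0" using A_nz R_zero by auto
        then show ?case using g_eq elim(1) by (simp add: h_def R_def B_def)
      qed
    qed
    then have "(h \<longlongrightarrow> 0) (at z)" by (rule tendsto_eventually)
    ultimately have "h z = 0" using tendsto_unique[of "at z" h] by (auto simp: isCont_def)
    then show ?thesis by (simp add: h_def)
  qed
  have nonzero_point: "\<exists>w\<in>B. F w \<noteq> 0" if "finite {z \<in> B. F z = 0}" for F :: "complex \<Rightarrow> complex"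
  proof (rule ccontr)
    assume "\<not> ?thesis"
    then have "{z \<in> B. F z = 0} = B" by auto
    then show False using that B by simp
  qed
  have analytic: "F analytic_on {z}" if "F holomorphic_on B" "z \<in> B" for F and z :: complex
    using that B analytic_at by blast
  \<comment> \<open>Applied with \<open>h = g\<close> to show that \<open>g\<close> has no zeros,
    and with h = g - c to compare multiplicities.\<close>
  have zorder_mult_R: "zorder F z = int (count (mset xs) z) + zorder h z \<and> 0 \<le> zorder h z \<and> (zorder h z = 0 \<longleftrightarrow> h z \<noteq> 0)"
    if F: "F holomorphic_on B" "h holomorphic_on B" "\<And>z. z \<in> B \<Longrightarrow> F z = A * R z * h z"
      "\<exists>w\<in>B. F w \<noteq> 0" and z: "z \<in> B" for F h z
  proof -
    have ev: "eventually (\<lambda>w. F w \<noteq> 0 \<and> w \<in> B) (at z)"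
      using eventually_neq_zero[OF F(1) B(1,2) z F(4)] B(1) z
      by (intro eventually_conj eventually_at_in_open')
    have evR: "eventually (\<lambda>w. A * R w * h w \<noteq> 0) (at z)" using ev by eventually_elim (metis F(3))
    have evA: "eventually (\<lambda>w. A * R w \<noteq> 0) (at z)" using evR by eventually_elim simp
    have evh: "eventually (\<lambda>w. h w \<noteq> 0) (at z)" using evR by eventually_elim simp
    have "zorder F z = zorder (\<lambda>w. A * R w * h w) z"
    proof (rule zorder_cong)
      show "eventually (\<lambda>w. F w = A * R w * h w) (at z)" using ev by eventually_elim (simp add: F(3))
    qed simp
    also have "\<dots> = zorder (\<lambda>w. A * R w) z + zorder h z"
      using F(2) R_hol z evR by (intro zorder_times_analytic analytic) (auto intro!: holomorphic_intros)
    also have "zorder (\<lambda>w. A * R w) z = zorder (\<lambda>_. A) z + zorder R z"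
      using R_hol z evA by (intro zorder_times_analytic analytic) auto
    also have "zorder (\<lambda>_. A) z = 0" using A_nz by (intro zorder_eq_0I) auto
    finally have "zorder F z = int (count (mset xs) z) + zorder h z" by (simp add: zorder_R)
    moreover have "0 \<le> zorder h z" "zorder h z = 0 \<longleftrightarrow> h z \<noteq> 0"
      using analytic[OF F(2) z] evh by (auto intro!: zorder_ge_0 zorder_eq_0_iff eventually_frequently)
    ultimately show ?thesis by simp
  qed
  have "finite {z \<in> B. f z = 0}" using nzeros by (auto simp: num_zeros_def B_def split: if_splits)
  then have f_nz: "\<exists>w\<in>B. f w \<noteq> 0" by (rule nonzero_point)
  have g_nz: "g z \<noteq> 0" if "z \<in> ball 0 1" for z
  proof -
    have z: "z \<in> B" using that by (simp add: B_def)
    have "g holomorphic_on B" using g_hol by (simp add: B_def)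
    note zo = zorder_mult_R[OF fhol this f_eq f_nz z]
    \<comment> \<open>\<open>R\<close> already carries the full order of \<open>f\<close> at
      \<open>z\<close>, which leaves order 0 for \<open>g\<close>.\<close>
    have "int (count (mset xs) z) = zorder f z"
      using zero_mult_eq_zorder[OF fhol B(1,2) z f_nz] xs_mult that by simp
    then show ?thesis using zo by simp
  qed
  have gv: "factors_valent p g"
    unfolding factors_valent_def
  proof
    fix c
    define Q where "Q = smult (c * A) (\<Prod>j<s. [:- (xs ! j), 1:])"
    define F where "F = (\<lambda>z. f z - poly Q z)"
    have polyQ: "poly Q z = c * A * R z" for z by (simp add: Q_def R_def poly_prod)
    have "degree Q \<le> degree (\<Prod>j<s. [:- (xs ! j), 1:])" unfolding Q_def by (rule degree_smult_le)
    also have "\<dots> \<le> (\<Sum>j<s. degree [:- (xs ! j), 1:])"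
      using degree_prod_sum_le[of "{..<s}" "\<lambda>j. [:- (xs ! j), 1:]"] by (simp add: o_def)
    finally have "degree Q \<le> s" by simp
    then have "num_zeros F B \<le> enat p" using valent by (simp add: sp_valent_def F_def B_def)
    then have F_fin: "finite {z \<in> B. F z = 0}" and F_sum: "(\<Sum>z\<in>{z \<in> B. F z = 0}. zero_mult F z) \<le> p"
      by (auto simp: num_zeros_def split: if_splits)
    have F_nz: "\<exists>w\<in>B. F w \<noteq> 0" using F_fin by (rule nonzero_point)
    have F_eq: "F z = A * R z * (g z - c)" if "z \<in> B" for z
      by (simp add: F_def polyQ f_eq[OF that] algebra_simps)
    have F_hol: "F holomorphic_on B" unfolding F_def using fhol by (intro holomorphic_intros)
    have gc_hol: "(\<lambda>z. g z - c) holomorphic_on B" using g_hol by (auto simp: B_def intro!: holomorphic_intros)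
    define Z where "Z = {z \<in> B. g z - c = 0}"
    have Z_sub: "Z \<subseteq> {z \<in> B. F z = 0}" by (auto simp: Z_def F_eq)
    then have Z_fin: "finite Z" using F_fin by (rule finite_subset)
    obtain m Q' where Q': "Q' holomorphic_on B" "\<forall>z\<in>B. Q' z \<noteq> 0 \<and> g z - c = (\<Prod>w\<in>Z. (z - w) ^ m w) * Q' z"
      using holomorphic_finite_zeros_factorization[OF Z_fin gc_hol B Z_def] by blast
    \<comment> \<open>A zero of g - c may coincide with a zero of \<open>R\<close>; this only raises
      the order of \<open>F\<close> there.\<close>
    have "m w \<le> zero_mult F w" if "w \<in> Z" for w
    proof -
      have w: "w \<in> B" using that by (simp add: Z_def)
      have "zorder (\<lambda>z. g z - c) w = int (m w)"
        using Q' w that by (intro zorder_factorization[OF Z_fin Q'(1) B(1)]) auto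
      then show ?thesis
        using zorder_mult_R[OF F_hol gc_hol F_eq F_nz w] zero_mult_eq_zorder[OF F_hol B(1,2) w F_nz] by linarith
    qed
    then have "sum m Z \<le> (\<Sum>z\<in>Z. zero_mult F z)" by (rule sum_mono)
    also have "\<dots> \<le> (\<Sum>z\<in>{z \<in> B. F z = 0}. zero_mult F z)" using Z_sub F_fin by (intro sum_mono2) auto
    also note F_sum
    finally show "\<exists>Z m Q. finite Z \<and> sum m Z \<le> p \<and> Q holomorphic_on ball 0 1 \<and>
        (\<forall>z\<in>ball 0 1. Q z \<noteq> 0 \<and> g z - c = (\<Prod>w\<in>Z. (z - w) ^ m w) * Q z)"
      using Z_fin Q' unfolding B_def by blast
  qed
  show ?thesis
  proof
    fix x :: complex assume x: "x \<in> ball 0 1"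
    have "cmod (1 / g x) \<le> ((1 + cmod x) / (1 - cmod x)) ^ (2 * p)"
      using g_hol g_nz g0 by (intro valent_upper_bound[OF _ _ _ factors_valent_inverse[OF g_hol g_nz gv] x])
        (auto intro!: holomorphic_intros)
    then have "inverse (((1 + cmod x) / (1 - cmod x)) ^ (2 * p)) \<le> inverse (cmod (1 / g x))"
      using g_nz[OF x] by (intro le_imp_inverse_le) auto
    then have "((1 - cmod x) / (1 + cmod x)) ^ (2 * p) \<le> cmod (g x)"
      by (simp add: norm_divide flip: power_inverse)
    with valent_upper_bound[OF g_hol g_nz g0 gv x]
    show "((1 - cmod x) / (1 + cmod x)) ^ (2 * p) \<le> cmod (g x) \<and> cmod (g x) \<le> ((1 + cmod x) / (1 - cmod x)) ^ (2 * p)" by simp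
  qed
qed

end
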